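(* Let $\kappa$ be a cardinal and let $\mathbb C_\kappa=\mathrm{Add}(\omega,\kappa)$ be the forcing adding $\kappa$ many Cohen reals. If $\mathcal E\subseteq\omega^\omega$ is a tight eventually different family, then $\Vdash_{\mathbb C_\kappa}$ "$\check{\mathcal E}$ is tight".
   Context: For $f,g\in\omega^\omega$, $f\neq^* g$ means there is $k<\omega$ with $f(n)\neq g(n)$ for all $n>k$. A set $\mathcal E\subseteq\omega^\omega$ is an eventually different family if $f\neq^* g$ for all distinct $f,g\in\mathcal E$. A tree is a set $T\subseteq\omega^{<\omega}$ closed under initial segments and pruned (every $t\in T$ has a proper extension in $T$). Functions and finite sequences are identified with their graphs (subsets of $\omega\times\omega$); for $t\in T$ let $T_t=\{s\in T: s\subseteq t\text{ or }t\subseteq s\}$. $\mathcal I_T(\mathcal E)^+$ is the set of trees $T$ such that for no $t\in T$ and no finite $X\subseteq\mathcal E$ is $\bigcup T_t\setminus\bigcup X$ finite. A function $g\in\omega^\omega$ densely diagonalizes a tree $T$ if for every $t\in T$ there are $s\in T$ with $s\supsetneq t$ and $k\in\mathrm{dom}(s)\setminus\mathrm{dom}(t)$ with $s(k)=g(k)$. $\mathcal E$ is tight if for every countable family $\{T_n:n<\omega\}\subseteq\mathcal I_T(\mathcal E)^+$ there is a single $g\in\mathcal E$ densely diagonalizing every $T_n$ (in the extension, trees and $\mathcal I_T(\check{\mathcal E})^+$ are computed there). *)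

theory Defs
  imports Main "HOL-Library.Sublist"
begin

unbundle cardinal_syntax

section \<open>Eventually different families, trees and tightness in the ground model\<close>

text \<open>
  The ground model is the universe of HOL: \<open>\<omega>\<^sup>\<omega>\<close> is \<^typ>\<open>nat \<Rightarrow> nat\<close> and
  \<open>\<omega>\<^sup><\<^sup>\<omega>\<close> is \<^typ>\<open>nat list\<close>. Inclusion of graphs of finite sequences is \<^const>\<open>prefix\<close>.
\<close>

definition eventually_different :: "(nat \<Rightarrow> nat) \<Rightarrow> (nat \<Rightarrow> nat) \<Rightarrow> bool" where
  "eventually_different f g \<longleftrightarrow> (\<exists>k. \<forall>n>k. f n \<noteq> g n)"

definition ed_family :: "(nat \<Rightarrow> nat) set \<Rightarrow> bool" where
  "ed_family E \<longleftrightarrow> (\<forall>f\<in>E. \<forall>g\<in>E. f \<noteq> g \<longrightarrow> eventually_different f g)"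

definition is_tree :: "nat list set \<Rightarrow> bool" where
  "is_tree T \<longleftrightarrow>
     (\<forall>t\<in>T. \<forall>s. prefix s t \<longrightarrow> s \<in> T) \<and> (\<forall>t\<in>T. \<exists>s\<in>T. strict_prefix t s)"

definition fun_graph :: "(nat \<Rightarrow> nat) \<Rightarrow> (nat \<times> nat) set" where
  "fun_graph f = {(n, f n) | n. True}"

definition seq_graph :: "nat list \<Rightarrow> (nat \<times> nat) set" where
  "seq_graph s = {(i, s ! i) | i. i < length s}"

definition subtree_at :: "nat list set \<Rightarrow> nat list \<Rightarrow> nat list set" where
  "subtree_at T t = {s\<in>T. prefix s t \<or> prefix t s}"

definition positive_trees :: "(nat \<Rightarrow> nat) set \<Rightarrow> nat list set set" where
  "positive_trees E = {T. is_tree T \<and>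
     \<not> (\<exists>t\<in>T. \<exists>X. finite X \<and> X \<subseteq> E \<and>
          finite (\<Union>(seq_graph ` subtree_at T t) - \<Union>(fun_graph ` X)))}"

definition densely_diagonalizes :: "(nat \<Rightarrow> nat) \<Rightarrow> nat list set \<Rightarrow> bool" where
  "densely_diagonalizes g T \<longleftrightarrow>
     (\<forall>t\<in>T. \<exists>s\<in>T. strict_prefix t s \<and>
        (\<exists>k. length t \<le> k \<and> k < length s \<and> s ! k = g k))"

definition tight :: "(nat \<Rightarrow> nat) set \<Rightarrow> bool" where
  "tight E \<longleftrightarrow>
     (\<forall>T :: nat \<Rightarrow> nat list set. (\<forall>n. T n \<in> positive_trees E) \<longrightarrow>
        (\<exists>g\<in>E. \<forall>n. densely_diagonalizes g (T n)))"


section \<open>Names\<close>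

text \<open>
  \<open>Name F\<close> is the name whose set of elements (pairs of a name and a condition) is the range of the
  partial function \<open>F\<close>. HOL has no type of all sets, so the number of
  elements of a name is bounded by an index type \<^typ>\<open>'i\<close>: if \<open>\<lambda> \<ge> \<aleph>\<^sub>0\<close> is the cardinality of
  \<^typ>\<open>'i\<close> and the forcing notion \<open>P\<close> has at most \<open>\<lambda>\<close> conditions, these are (up to
  repetition of indices) exactly the \<open>P\<close>-names in \<open>H(\<lambda>\<^sup>+)\<close>, and their values in a generic
  extension are exactly the elements of \<open>H(\<lambda>\<^sup>+)\<close> of the extension. A statement all of whose
  quantifiers can be restricted to \<open>H(\<lambda>\<^sup>+)\<close> is thus forced in the sense below iff it is
  forced in the usual sense.
\<close>

datatype ('i, 'p) pname = Name "'i \<Rightarrow> (('i, 'p) pname \<times> 'p) option"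

primrec elts :: "('i, 'p) pname \<Rightarrow> (('i, 'p) pname \<times> 'p) set" where
  "elts (Name F) = ran F"

lemma ran_map_option: "ran (\<lambda>i. map_option h (F i)) = h ` ran F"
  by (force simp: ran_def)

lemma pname_elts_induct [case_names elts]:
  assumes "\<And>\<tau>. (\<And>\<sigma> s. (\<sigma>, s) \<in> elts \<tau> \<Longrightarrow> Q \<sigma>) \<Longrightarrow> Q \<tau>"
  shows "Q \<tau>"
proof (induction \<tau>)
  case (Name F)
  show ?case
  proof (rule assms)
    fix \<sigma> s
    assume "(\<sigma>, s) \<in> elts (Name F)"
    then obtain i where "F i = Some (\<sigma>, s)"
      by (auto simp: ran_def)
    then show "Q \<sigma>"
      by (intro Name.IH[of "F i" "(\<sigma>, s)" \<sigma>]) (auto simp: rangeI intro: range_eqI[of _ _ i])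
  qed
qed

text \<open>The name with the given elements, which exists if there are at most \<open>|UNIV :: 'i set|\<close> of them.\<close>

definition name_of :: "(('i, 'p) pname \<times> 'p) set \<Rightarrow> ('i, 'p) pname" where
  "name_of A = (SOME \<tau>. elts \<tau> = A)"

lemma elts_name_of:
  fixes A :: "(('i, 'p) pname \<times> 'p) set"
  assumes "|A| \<le>o |UNIV :: 'i set|"
  shows "elts (name_of A) = A"
proof -
  obtain h :: "('i, 'p) pname \<times> 'p \<Rightarrow> 'i" where h: "inj_on h A"
    using assms by (auto simp: card_of_ordLeq[symmetric])
  have "elts (Name (\<lambda>i. if i \<in> h ` A then Some (inv_into A h i) else None)) = A"
    using h by (auto simp: ran_def inv_into_into) (metis imageI inv_into_f_f)
  then show ?thesis
    unfolding name_of_def by (rule someI)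
qed


section \<open>The forcing relation\<close>

locale forcing_notion =
  fixes P :: "'p set"
    and le :: "'p \<Rightarrow> 'p \<Rightarrow> bool"  (infix \<open>\<preceq>\<close> 50)
    and one :: 'p  (\<open>\<one>\<close>)
  assumes le_refl: "p \<in> P \<Longrightarrow> p \<preceq> p"
    and le_trans: "\<lbrakk>p \<in> P; q \<in> P; r \<in> P; p \<preceq> q; q \<preceq> r\<rbrakk> \<Longrightarrow> p \<preceq> r"
    and one_in: "\<one> \<in> P"
    and le_one: "p \<in> P \<Longrightarrow> p \<preceq> \<one>"
begin

primrec is_name :: "('i, 'p) pname \<Rightarrow> bool" where
  "is_name (Name F) \<longleftrightarrow>
     (\<forall>(b, s)\<in>ran (\<lambda>i. map_option (map_prod is_name id) (F i)). b \<and> s \<in> P)"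

lemma is_name_iff: "is_name \<tau> \<longleftrightarrow> (\<forall>(\<sigma>, s)\<in>elts \<tau>. is_name \<sigma> \<and> s \<in> P)"
  by (cases \<tau>) (auto simp: ran_map_option)

definition dense_below :: "'p \<Rightarrow> 'p set \<Rightarrow> bool" where
  "dense_below p D \<longleftrightarrow> (\<forall>q\<in>P. q \<preceq> p \<longrightarrow> (\<exists>r\<in>P. r \<preceq> q \<and> r \<in> D))"

text \<open>
  A sentence \<open>\<phi>\<close> of the forcing language (a formula of set theory with names as parameters) is
  represented by the predicate \<open>\<lambda>p. p \<tturnstile> \<phi>\<close> on conditions. The clauses for
  \<open>=\<close>, \<open>\<in>\<close>, \<open>\<not>\<close>, \<open>\<and>\<close>, \<open>\<forall>\<close> are the usual recursive definition of \<open>\<tturnstile>\<close>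
  in the ground model (Kunen's \<open>\<tturnstile>\<^sup>*\<close>); the recursions for names and for \<open>=\<close> are
  restated in terms of \<^const>\<open>elts\<close> in \<open>is_name_iff\<close> and \<open>forces_eq_iff\<close>. The other connectives are abbreviations in classical logic.
\<close>

primrec forces_eq :: "('i, 'p) pname \<Rightarrow> ('i, 'p) pname \<Rightarrow> 'p \<Rightarrow> bool"  (infix \<open>\<^bold>=\<close> 50) where
  "forces_eq (Name F) = (\<lambda>\<tau> p.
     let A = ran (\<lambda>i. map_option (map_prod forces_eq id) (F i)) in
     (\<forall>(e, s\<^sub>1)\<in>A. dense_below p
        {q. q \<preceq> s\<^sub>1 \<longrightarrow> (\<exists>(\<pi>\<^sub>2, s\<^sub>2)\<in>elts \<tau>. q \<preceq> s\<^sub>2 \<and> e \<pi>\<^sub>2 q)}) \<and>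
     (\<forall>(\<pi>\<^sub>2, s\<^sub>2)\<in>elts \<tau>. dense_below p
        {q. q \<preceq> s\<^sub>2 \<longrightarrow> (\<exists>(e, s\<^sub>1)\<in>A. q \<preceq> s\<^sub>1 \<and> e \<pi>\<^sub>2 q)}))"

lemma forces_eq_iff:
  "(\<sigma> \<^bold>= \<tau>) p \<longleftrightarrow>
     (\<forall>(\<pi>\<^sub>1, s\<^sub>1)\<in>elts \<sigma>. dense_below p
        {q. q \<preceq> s\<^sub>1 \<longrightarrow> (\<exists>(\<pi>\<^sub>2, s\<^sub>2)\<in>elts \<tau>. q \<preceq> s\<^sub>2 \<and> (\<pi>\<^sub>1 \<^bold>= \<pi>\<^sub>2) q)}) \<and>
     (\<forall>(\<pi>\<^sub>2, s\<^sub>2)\<in>elts \<tau>. dense_below p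
        {q. q \<preceq> s\<^sub>2 \<longrightarrow> (\<exists>(\<pi>\<^sub>1, s\<^sub>1)\<in>elts \<sigma>. q \<preceq> s\<^sub>1 \<and> (\<pi>\<^sub>1 \<^bold>= \<pi>\<^sub>2) q)})"
  by (cases \<sigma>) (simp add: ran_map_option case_prod_unfold)

definition forces_mem :: "('i, 'p) pname \<Rightarrow> ('i, 'p) pname \<Rightarrow> 'p \<Rightarrow> bool"  (infix \<open>\<^bold>\<in>\<close> 50) where
  "(\<sigma> \<^bold>\<in> \<tau>) p \<longleftrightarrow> dense_below p {q. \<exists>(\<pi>, s)\<in>elts \<tau>. q \<preceq> s \<and> (\<sigma> \<^bold>= \<pi>) q}"

definition forces_not :: "('p \<Rightarrow> bool) \<Rightarrow> 'p \<Rightarrow> bool"  (\<open>\<^bold>\<not> _\<close> [40] 40) where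
  "(\<^bold>\<not> \<phi>) p \<longleftrightarrow> (\<forall>q\<in>P. q \<preceq> p \<longrightarrow> \<not> \<phi> q)"

definition forces_and :: "('p \<Rightarrow> bool) \<Rightarrow> ('p \<Rightarrow> bool) \<Rightarrow> 'p \<Rightarrow> bool"  (infixr \<open>\<^bold>\<and>\<close> 35) where
  "(\<phi> \<^bold>\<and> \<psi>) p \<longleftrightarrow> \<phi> p \<and> \<psi> p"

definition forces_all :: "(('i, 'p) pname \<Rightarrow> 'p \<Rightarrow> bool) \<Rightarrow> 'p \<Rightarrow> bool"  (binder \<open>\<^bold>\<forall>\<close> 10) where
  "(\<^bold>\<forall>x. \<phi> x) p \<longleftrightarrow> (\<forall>\<tau>. is_name \<tau> \<longrightarrow> \<phi> \<tau> p)"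

definition forces_or :: "('p \<Rightarrow> bool) \<Rightarrow> ('p \<Rightarrow> bool) \<Rightarrow> 'p \<Rightarrow> bool"  (infixr \<open>\<^bold>\<or>\<close> 30) where
  "(\<phi> \<^bold>\<or> \<psi>) = (\<^bold>\<not> (\<^bold>\<not> \<phi> \<^bold>\<and> \<^bold>\<not> \<psi>))"

definition forces_imp :: "('p \<Rightarrow> bool) \<Rightarrow> ('p \<Rightarrow> bool) \<Rightarrow> 'p \<Rightarrow> bool"  (infixr \<open>\<^bold>\<longrightarrow>\<close> 25) where
  "(\<phi> \<^bold>\<longrightarrow> \<psi>) = (\<^bold>\<not> (\<phi> \<^bold>\<and> \<^bold>\<not> \<psi>))"

definition forces_iff :: "('p \<Rightarrow> bool) \<Rightarrow> ('p \<Rightarrow> bool) \<Rightarrow> 'p \<Rightarrow> bool"  (infixr \<open>\<^bold>\<longleftrightarrow>\<close> 25) where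
  "(\<phi> \<^bold>\<longleftrightarrow> \<psi>) = ((\<phi> \<^bold>\<longrightarrow> \<psi>) \<^bold>\<and> (\<psi> \<^bold>\<longrightarrow> \<phi>))"

definition forces_ex :: "(('i, 'p) pname \<Rightarrow> 'p \<Rightarrow> bool) \<Rightarrow> 'p \<Rightarrow> bool"  (binder \<open>\<^bold>\<exists>\<close> 10) where
  "(\<^bold>\<exists>x. \<phi> x) = (\<^bold>\<not> (\<^bold>\<forall>x. \<^bold>\<not> \<phi> x))"

text \<open>\<open>\<tturnstile> \<phi>\<close>, i.e. every condition forces \<open>\<phi>\<close>.\<close>

definition forced :: "('p \<Rightarrow> bool) \<Rightarrow> bool" where
  "forced \<phi> \<longleftrightarrow> (\<forall>p\<in>P. \<phi> p)"


section \<open>Check names of reals and of families of reals\<close>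

text \<open>
  Natural numbers are von Neumann ordinals, pairs are Kuratowski pairs and functions are their
  graphs.
\<close>

definition check_set :: "('i, 'p) pname set \<Rightarrow> ('i, 'p) pname" where
  "check_set A = name_of ((\<lambda>\<tau>. (\<tau>, \<one>)) ` A)"

fun check_nat :: "nat \<Rightarrow> ('i, 'p) pname" where
  "check_nat n = check_set (set (map check_nat [0..<n]))"

declare check_nat.simps [simp del]

lemma check_nat_eq: "check_nat n = check_set (check_nat ` {m. m < n})"
  by (subst check_nat.simps) (simp add: atLeast0LessThan lessThan_def)

definition check_pair :: "nat \<Rightarrow> nat \<Rightarrow> ('i, 'p) pname" where
  "check_pair m n =
     check_set {check_set {check_nat m}, check_set {check_nat m, check_nat n}}"

definition check_real :: "(nat \<Rightarrow> nat) \<Rightarrow> ('i, 'p) pname" where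
  "check_real f = check_set (range (\<lambda>n. check_pair n (f n)))"

definition check_family :: "(nat \<Rightarrow> nat) set \<Rightarrow> ('i, 'p) pname" where
  "check_family E = check_set (check_real ` E)"


section \<open>Tightness in the extension\<close>

definition fm_subset :: "('i, 'p) pname \<Rightarrow> ('i, 'p) pname \<Rightarrow> 'p \<Rightarrow> bool"  (infix \<open>\<^bold>\<subseteq>\<close> 50) where
  "(x \<^bold>\<subseteq> y) = (\<^bold>\<forall>z. z \<^bold>\<in> x \<^bold>\<longrightarrow> z \<^bold>\<in> y)"

definition fm_upair :: "('i, 'p) pname \<Rightarrow> ('i, 'p) pname \<Rightarrow> ('i, 'p) pname \<Rightarrow> 'p \<Rightarrow> bool" where
  "fm_upair x y z = (\<^bold>\<forall>u. u \<^bold>\<in> z \<^bold>\<longleftrightarrow> (u \<^bold>= x \<^bold>\<or> u \<^bold>= y))"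

text \<open>\<open>z = \<langle>x, y\<rangle>\<close>\<close>
definition fm_pair :: "('i, 'p) pname \<Rightarrow> ('i, 'p) pname \<Rightarrow> ('i, 'p) pname \<Rightarrow> 'p \<Rightarrow> bool" where
  "fm_pair x y z = (\<^bold>\<exists>u. \<^bold>\<exists>v. fm_upair x x u \<^bold>\<and> fm_upair x y v \<^bold>\<and> fm_upair u v z)"

text \<open>\<open>\<langle>x, y\<rangle> \<in> f\<close>\<close>
definition fm_app :: "('i, 'p) pname \<Rightarrow> ('i, 'p) pname \<Rightarrow> ('i, 'p) pname \<Rightarrow> 'p \<Rightarrow> bool" where
  "fm_app f x y = (\<^bold>\<exists>z. fm_pair x y z \<^bold>\<and> z \<^bold>\<in> f)"

text \<open>\<open>f : a \<rightarrow> b\<close>\<close>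
definition fm_fun :: "('i, 'p) pname \<Rightarrow> ('i, 'p) pname \<Rightarrow> ('i, 'p) pname \<Rightarrow> 'p \<Rightarrow> bool" where
  "fm_fun f a b =
     ((\<^bold>\<forall>z. z \<^bold>\<in> f \<^bold>\<longrightarrow> (\<^bold>\<exists>x. \<^bold>\<exists>y. x \<^bold>\<in> a \<^bold>\<and> y \<^bold>\<in> b \<^bold>\<and> fm_pair x y z)) \<^bold>\<and>
      (\<^bold>\<forall>x. x \<^bold>\<in> a \<^bold>\<longrightarrow> (\<^bold>\<exists>y. fm_app f x y)) \<^bold>\<and>
      (\<^bold>\<forall>x. \<^bold>\<forall>y. \<^bold>\<forall>y'. fm_app f x y \<^bold>\<and> fm_app f x y' \<^bold>\<longrightarrow> y \<^bold>= y'))"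

definition fm_inductive :: "('i, 'p) pname \<Rightarrow> 'p \<Rightarrow> bool" where
  "fm_inductive w =
     ((\<^bold>\<exists>x. x \<^bold>\<in> w \<^bold>\<and> (\<^bold>\<forall>u. \<^bold>\<not> u \<^bold>\<in> x)) \<^bold>\<and>
      (\<^bold>\<forall>x. x \<^bold>\<in> w \<^bold>\<longrightarrow> (\<^bold>\<exists>y. y \<^bold>\<in> w \<^bold>\<and> (\<^bold>\<forall>u. u \<^bold>\<in> y \<^bold>\<longleftrightarrow> (u \<^bold>\<in> x \<^bold>\<or> u \<^bold>= x)))))"

text \<open>\<open>w = \<omega>\<close>, the least inductive set\<close>
definition fm_omega :: "('i, 'p) pname \<Rightarrow> 'p \<Rightarrow> bool" where
  "fm_omega w = (fm_inductive w \<^bold>\<and> (\<^bold>\<forall>v. fm_inductive v \<^bold>\<longrightarrow> w \<^bold>\<subseteq> v))"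

text \<open>
  In the following formulas the parameter \<open>w\<close> stands for \<open>\<omega>\<close>, as fixed in \<open>fm_tight\<close>.
\<close>

definition fm_finite :: "('i, 'p) pname \<Rightarrow> ('i, 'p) pname \<Rightarrow> 'p \<Rightarrow> bool" where
  "fm_finite w x =
     (\<^bold>\<exists>n. \<^bold>\<exists>f. n \<^bold>\<in> w \<^bold>\<and> fm_fun f n x \<^bold>\<and>
        (\<^bold>\<forall>y. y \<^bold>\<in> x \<^bold>\<longrightarrow> (\<^bold>\<exists>m. fm_app f m y)) \<^bold>\<and>
        (\<^bold>\<forall>m. \<^bold>\<forall>m'. \<^bold>\<forall>y. fm_app f m y \<^bold>\<and> fm_app f m' y \<^bold>\<longrightarrow> m \<^bold>= m'))"

text \<open>\<open>s \<in> \<omega>\<^sup><\<^sup>\<omega>\<close>\<close>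
definition fm_seq :: "('i, 'p) pname \<Rightarrow> ('i, 'p) pname \<Rightarrow> 'p \<Rightarrow> bool" where
  "fm_seq w s = (\<^bold>\<exists>n. n \<^bold>\<in> w \<^bold>\<and> fm_fun s n w)"

definition fm_tree :: "('i, 'p) pname \<Rightarrow> ('i, 'p) pname \<Rightarrow> 'p \<Rightarrow> bool" where
  "fm_tree w T =
     ((\<^bold>\<forall>t. t \<^bold>\<in> T \<^bold>\<longrightarrow> fm_seq w t) \<^bold>\<and>
      (\<^bold>\<forall>t. \<^bold>\<forall>s. t \<^bold>\<in> T \<^bold>\<and> fm_seq w s \<^bold>\<and> s \<^bold>\<subseteq> t \<^bold>\<longrightarrow> s \<^bold>\<in> T) \<^bold>\<and>
      (\<^bold>\<forall>t. t \<^bold>\<in> T \<^bold>\<longrightarrow> (\<^bold>\<exists>s. s \<^bold>\<in> T \<^bold>\<and> t \<^bold>\<subseteq> s \<^bold>\<and> \<^bold>\<not> t \<^bold>= s)))"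

text \<open>\<open>D = \<Union>T\<^sub>t \<setminus> \<Union>X\<close>\<close>
definition fm_rest ::
  "('i, 'p) pname \<Rightarrow> ('i, 'p) pname \<Rightarrow> ('i, 'p) pname \<Rightarrow> ('i, 'p) pname \<Rightarrow> 'p \<Rightarrow> bool" where
  "fm_rest T t X D =
     (\<^bold>\<forall>z. z \<^bold>\<in> D \<^bold>\<longleftrightarrow>
        ((\<^bold>\<exists>s. s \<^bold>\<in> T \<^bold>\<and> (s \<^bold>\<subseteq> t \<^bold>\<or> t \<^bold>\<subseteq> s) \<^bold>\<and> z \<^bold>\<in> s) \<^bold>\<and>
         \<^bold>\<not> (\<^bold>\<exists>f. f \<^bold>\<in> X \<^bold>\<and> z \<^bold>\<in> f)))"

definition fm_positive :: "('i, 'p) pname \<Rightarrow> ('i, 'p) pname \<Rightarrow> ('i, 'p) pname \<Rightarrow> 'p \<Rightarrow> bool" where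
  "fm_positive w E T =
     (fm_tree w T \<^bold>\<and>
      \<^bold>\<not> (\<^bold>\<exists>t. \<^bold>\<exists>X. t \<^bold>\<in> T \<^bold>\<and> fm_finite w X \<^bold>\<and> X \<^bold>\<subseteq> E \<^bold>\<and>
           (\<^bold>\<exists>D. fm_rest T t X D \<^bold>\<and> fm_finite w D)))"

definition fm_densely_diagonalizes :: "('i, 'p) pname \<Rightarrow> ('i, 'p) pname \<Rightarrow> 'p \<Rightarrow> bool" where
  "fm_densely_diagonalizes g T =
     (\<^bold>\<forall>t. t \<^bold>\<in> T \<^bold>\<longrightarrow>
        (\<^bold>\<exists>s. s \<^bold>\<in> T \<^bold>\<and> t \<^bold>\<subseteq> s \<^bold>\<and> \<^bold>\<not> t \<^bold>= s \<^bold>\<and>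
           (\<^bold>\<exists>k. \<^bold>\<exists>y. \<^bold>\<not> (\<^bold>\<exists>y'. fm_app t k y') \<^bold>\<and> fm_app s k y \<^bold>\<and> fm_app g k y)))"

text \<open>
  \<open>E\<close> is tight. All quantifiers here range over elements of \<open>H(\<lambda>\<^sup>+)\<close> for infinite
  \<open>\<lambda> \<ge> |E|\<close>. The countable family \<open>{T\<^sub>n | n < \<omega>}\<close> is given by a function \<open>F\<close> with
  domain \<open>\<omega>\<close>.
\<close>

definition fm_tight :: "('i, 'p) pname \<Rightarrow> 'p \<Rightarrow> bool" where
  "fm_tight E =
     (\<^bold>\<forall>w. fm_omega w \<^bold>\<longrightarrow>
        (\<^bold>\<forall>F. (\<^bold>\<exists>b. fm_fun F w b) \<^bold>\<and>
             (\<^bold>\<forall>n. \<^bold>\<forall>T. n \<^bold>\<in> w \<^bold>\<and> fm_app F n T \<^bold>\<longrightarrow> fm_positive w E T) \<^bold>\<longrightarrow>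
           (\<^bold>\<exists>g. g \<^bold>\<in> E \<^bold>\<and>
             (\<^bold>\<forall>n. \<^bold>\<forall>T. n \<^bold>\<in> w \<^bold>\<and> fm_app F n T \<^bold>\<longrightarrow> fm_densely_diagonalizes g T))))"

end


section \<open>Cohen forcing\<close>

text \<open>
  The finite partial functions from \<open>\<kappa> \<times> \<omega>\<close> to \<open>2\<close>, where a cardinal is a cardinal order
  \<open>\<kappa>\<close> and its set of elements is \<^term>\<open>Field \<kappa>\<close>; \<open>q\<close> is stronger than \<open>p\<close> iff \<open>q \<supseteq> p\<close>.
\<close>

definition Add_omega :: "'k rel \<Rightarrow> ('k \<times> nat \<Rightarrow> bool option) set" where
  "Add_omega \<kappa> = {p. finite (dom p) \<and> dom p \<subseteq> Field \<kappa> \<times> UNIV}"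

definition Add_le :: "('k \<times> nat \<Rightarrow> bool option) \<Rightarrow> ('k \<times> nat \<Rightarrow> bool option) \<Rightarrow> bool" where
  "Add_le q p \<longleftrightarrow> p \<subseteq>\<^sub>m q"

lemma forcing_notion_Add: "forcing_notion (Add_omega \<kappa>) Add_le Map.empty"
  by unfold_locales
    (auto simp: Add_omega_def Add_le_def intro: map_le_trans)

end

theory Submission
  imports Defs "HOL-Library.Countable_Set"
begin

text \<open>
  Let \<open>F\<close> name a sequence of positive trees. For a condition \<open>q\<close> and \<open>m < \<omega>\<close>, the ground model tree
  \<open>T\<^sub>q\<^sub>,\<^sub>m\<close> of all \<open>s\<close> that some extension of \<open>q\<close> puts into the \<open>m\<close>-th tree is positive: if
  \<open>\<Union>(T\<^sub>q\<^sub>,\<^sub>m)\<^sub>t \<setminus> \<Union>X\<close> were finite, an extension of \<open>q\<close> putting \<open>t\<close> into the \<open>m\<close>-th tree would force the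
  corresponding remainder of that tree to be finite as well. There are only countably many such
  trees, because \<open>T\<^sub>q\<^sub>,\<^sub>m\<close> depends only on the restriction of \<open>q\<close> to a suitable countable set
  of coordinates, obtained by closing off under witnesses (so neither the countable chain condition
  nor nice names are needed). A single \<open>g \<in> E\<close> densely diagonalizing all \<open>T\<^sub>q\<^sub>,\<^sub>m\<close> densely
  diagonalizes the trees in the extension, by density.

  Formulas are handled as predicates on conditions that are regular, i.e. true at \<open>p\<close> iff true
  densely below \<open>p\<close>; to prove a regular predicate at \<open>p\<close> one may pass to extensions of \<open>p\<close>
  providing witnesses for the existential, disjunctive and membership assumptions.
\<close>

text \<open>The extension may have new finite sets and new sequences of trees, but little about them
  has to be decided. Forced positivity is used only against check names of finite subsets of
  \<open>E\<close> from the ground model, so no finite subset of \<open>E\<close> in the extension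
  is ever analysed. The \<open>m\<close>-th tree gets no fixed name either: any two names for the
  value of \<open>F\<close> at \<open>m\<close> are identified by functionality of \<open>F\<close>.
  The density step runs as follows. Let \<open>u\<close> be a node of the \<open>m\<close>-th tree
  and \<open>c\<close> any later condition. Then \<open>u\<close> is a possible node for
  \<open>c\<close>, so \<open>g\<close> yields a longer possible node \<open>s\<close> that meets
  \<open>g\<close> beyond \<open>u\<close>, and some extension of \<open>c\<close> puts
  \<open>s\<close> into the \<open>m\<close>-th tree. The tree must belong to \<open>c\<close>
  itself, since a node possible for a weaker condition may be excluded by \<open>c\<close>. Hence
  all conditions are treated at once, and countability of the family of trees becomes the crux. In
  the formulas, \<omega> is an arbitrary \<open>w\<close> satisfying \<open>fm_omega\<close>, and
  numbers and finite sequences of the extension turn into check names only after passing to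
  extensions.\<close>

context forcing_notion
begin

section \<open>Regular predicates on conditions\<close>

text \<open>Both memberships in \<open>P\<close> are built in, so that every passage to an extension
  carries the side conditions of the forcing clauses along.\<close>

definition ext :: "'p \<Rightarrow> 'p \<Rightarrow> bool"  (infix \<open>\<sqsubseteq>\<close> 50) where
  "q \<sqsubseteq> p \<longleftrightarrow> q \<in> P \<and> p \<in> P \<and> q \<preceq> p"

lemma ext_refl [simp]: "p \<in> P \<Longrightarrow> p \<sqsubseteq> p"
  by (simp add: ext_def le_refl)

lemma ext_trans [trans]: "r \<sqsubseteq> q \<Longrightarrow> q \<sqsubseteq> p \<Longrightarrow> r \<sqsubseteq> p"
  by (auto simp: ext_def intro: le_trans)

lemma ext_le: "r \<sqsubseteq> q \<Longrightarrow> q \<preceq> s \<Longrightarrow> s \<in> P \<Longrightarrow> r \<preceq> s"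
  by (auto simp: ext_def intro: le_trans)

lemma ext_in: "q \<sqsubseteq> p \<Longrightarrow> q \<in> P" "q \<sqsubseteq> p \<Longrightarrow> p \<in> P"
  by (auto simp: ext_def)

lemma dense_below_ext:
  "p \<in> P \<Longrightarrow> dense_below p D \<longleftrightarrow> (\<forall>q. q \<sqsubseteq> p \<longrightarrow> (\<exists>r. r \<sqsubseteq> q \<and> r \<in> D))"
  by (auto simp: dense_below_def ext_def)

text \<open>The conditions satisfying such a predicate form a regular open set, that is, a truth
  value in the Boolean completion of \<open>P\<close>.\<close>

definition reg :: "('p \<Rightarrow> bool) \<Rightarrow> bool" where
  "reg \<phi> \<longleftrightarrow> (\<forall>p\<in>P. \<phi> p \<longleftrightarrow> dense_below p {q. \<phi> q})"

lemma regI: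
  assumes "\<And>p q. \<phi> p \<Longrightarrow> q \<sqsubseteq> p \<Longrightarrow> \<phi> q"
    and "\<And>p. p \<in> P \<Longrightarrow> (\<And>q. q \<sqsubseteq> p \<Longrightarrow> \<exists>r. r \<sqsubseteq> q \<and> \<phi> r) \<Longrightarrow> \<phi> p"
  shows "reg \<phi>"
  unfolding reg_def
proof (intro ballI iffI)
  fix p assume "p \<in> P" "\<phi> p"
  then show "dense_below p {q. \<phi> q}"
    using assms(1)[of p] ext_refl ext_in(1) unfolding dense_below_ext[OF \<open>p \<in> P\<close>] by blast
next
  fix p assume "p \<in> P" "dense_below p {q. \<phi> q}"
  then show "\<phi> p"
    using assms(2)[of p] by (auto simp: dense_below_ext)
qed

lemma dense_below_mono: "dense_below p D \<Longrightarrow> q \<sqsubseteq> p \<Longrightarrow> dense_below q D"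
  by (auto simp: dense_below_ext ext_in intro: ext_trans)

lemma reg_mono: "reg \<phi> \<Longrightarrow> \<phi> p \<Longrightarrow> q \<sqsubseteq> p \<Longrightarrow> \<phi> q"
  using dense_below_mono[of p "{q. \<phi> q}" q] by (auto simp: reg_def ext_in)

lemma reg_dense:
  "reg \<phi> \<Longrightarrow> p \<in> P \<Longrightarrow> (\<And>q. q \<sqsubseteq> p \<Longrightarrow> \<exists>r. r \<sqsubseteq> q \<and> \<phi> r) \<Longrightarrow> \<phi> p"
  unfolding reg_def by (simp add: dense_below_ext)

text \<open>All eliminations of existential, disjunctive and membership assumptions rest on this:
  every condition below \<open>p\<close> extends into \<open>D\<close>, where \<open>\<psi>\<close>
  is known, and regularity carries \<open>\<psi>\<close> back up to \<open>p\<close>.\<close>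

lemma dense_elim:
  assumes "dense_below p D" "p \<in> P" "reg \<psi>"
    and "\<And>q. q \<sqsubseteq> p \<Longrightarrow> q \<in> D \<Longrightarrow> \<psi> q"
  shows "\<psi> p"
  using assms(3,2)
proof (rule reg_dense)
  fix q assume "q \<sqsubseteq> p"
  then show "\<exists>r. r \<sqsubseteq> q \<and> \<psi> r"
    using assms by (meson dense_below_ext ext_trans)
qed

lemma dense_belowI: "q \<in> D \<Longrightarrow> q \<in> P \<Longrightarrow> (\<And>r. r \<sqsubseteq> q \<Longrightarrow> r \<in> D) \<Longrightarrow> dense_below q D"
  by (meson dense_below_ext ext_in ext_refl)

text \<open>With constant predicates as goals, forced assumptions can be eliminated in favour of
  statements about the ground model, among them \<open>False\<close> and the existence of a suitable
  condition.\<close>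

lemma reg_const [simp]: "reg (\<lambda>_. c)"
  by (rule regI) (auto intro: ext_refl)

lemma reg_dense_below [simp]: "reg (\<lambda>p. dense_below p D)"
proof (rule regI[OF dense_below_mono])
  fix p assume p: "p \<in> P" "\<And>q. q \<sqsubseteq> p \<Longrightarrow> \<exists>r. r \<sqsubseteq> q \<and> dense_below r D"
  have "\<exists>r. r \<sqsubseteq> q \<and> r \<in> D" if q: "q \<sqsubseteq> p" for q
  proof -
    obtain r where r: "r \<sqsubseteq> q" "dense_below r D" using p(2)[OF q] by blast
    then obtain r' where "r' \<sqsubseteq> r" "r' \<in> D"
      using ext_refl[of r] dense_below_ext[of r D] ext_in(1)[OF r(1)] by blast
    then show ?thesis using r ext_trans by blast
  qed
  then show "dense_below p D"
    using p by (simp add: dense_below_ext)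
qed

lemma reg_Ball:
  assumes "\<And>x. x \<in> A \<Longrightarrow> reg (\<phi> x)"
  shows "reg (\<lambda>p. \<forall>x\<in>A. \<phi> x p)"
proof (rule regI)
  fix p assume "p \<in> P" "\<And>q. q \<sqsubseteq> p \<Longrightarrow> \<exists>r. r \<sqsubseteq> q \<and> (\<forall>x\<in>A. \<phi> x r)"
  then show "\<forall>x\<in>A. \<phi> x p"
    using reg_dense[OF assms] by fast
qed (use reg_mono[OF assms] in fast)

lemma reg_conj:
  assumes "reg \<phi>" "reg \<psi>"
  shows "reg (\<lambda>p. \<phi> p \<and> \<psi> p)"
proof (rule regI)
  fix p assume "p \<in> P" "\<And>q. q \<sqsubseteq> p \<Longrightarrow> \<exists>r. r \<sqsubseteq> q \<and> (\<phi> r \<and> \<psi> r)"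
  then show "\<phi> p \<and> \<psi> p"
    using reg_dense[OF assms(1)] reg_dense[OF assms(2)] by fast
qed (use reg_mono[OF assms(1)] reg_mono[OF assms(2)] in fast)

lemma reg_mem [simp]: "reg (\<sigma> \<^bold>\<in> \<tau>)"
  using reg_dense_below by (simp add: forces_mem_def[abs_def])

lemma reg_eq [simp]: "reg (\<sigma> \<^bold>= \<tau>)"
proof -
  have "reg (\<lambda>p. (\<sigma> \<^bold>= \<tau>) p)"
    by (subst forces_eq_iff, unfold case_prod_unfold) (intro reg_conj reg_Ball reg_dense_below)
  then show ?thesis .
qed

lemma reg_not [simp]:
  assumes "reg \<phi>"
  shows "reg (\<^bold>\<not> \<phi>)"
proof (rule regI)
  fix p assume "p \<in> P" and *: "\<And>q. q \<sqsubseteq> p \<Longrightarrow> \<exists>r. r \<sqsubseteq> q \<and> (\<^bold>\<not> \<phi>) r"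
  have "\<not> \<phi> q" if q: "q \<sqsubseteq> p" for q
  proof
    assume "\<phi> q"
    obtain r where "r \<sqsubseteq> q" "(\<^bold>\<not> \<phi>) r" using *[OF q] by blast
    then show False
      using reg_mono[OF assms \<open>\<phi> q\<close>, of r] ext_refl[of r] by (auto simp: forces_not_def ext_def)
  qed
  then show "(\<^bold>\<not> \<phi>) p"
    using \<open>p \<in> P\<close> by (auto simp: forces_not_def ext_def)
qed (auto simp: forces_not_def ext_def intro: le_trans)

lemma reg_and [simp]: "reg \<phi> \<Longrightarrow> reg \<psi> \<Longrightarrow> reg (\<phi> \<^bold>\<and> \<psi>)"
  using reg_conj by (simp add: forces_and_def[abs_def])

lemma reg_all [simp]: "(\<And>x. reg (\<phi> x)) \<Longrightarrow> reg (\<^bold>\<forall>x. \<phi> x)"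
  using reg_Ball[of "{x. is_name x}" \<phi>] by (simp add: forces_all_def[abs_def])

lemma reg_or [simp]: "reg \<phi> \<Longrightarrow> reg \<psi> \<Longrightarrow> reg (\<phi> \<^bold>\<or> \<psi>)"
  and reg_imp [simp]: "reg \<phi> \<Longrightarrow> reg \<psi> \<Longrightarrow> reg (\<phi> \<^bold>\<longrightarrow> \<psi>)"
  and reg_iff [simp]: "reg \<phi> \<Longrightarrow> reg \<psi> \<Longrightarrow> reg (\<phi> \<^bold>\<longleftrightarrow> \<psi>)"
  and reg_ex [simp]: "(\<And>x. reg (\<chi> x)) \<Longrightarrow> reg (\<^bold>\<exists>x. \<chi> x)"
  by (simp_all add: forces_or_def forces_imp_def forces_iff_def forces_ex_def)

section \<open>Forcing clauses and proof rules for the connectives\<close>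

lemma not_iff: "p \<in> P \<Longrightarrow> (\<^bold>\<not> \<phi>) p \<longleftrightarrow> (\<forall>q. q \<sqsubseteq> p \<longrightarrow> \<not> \<phi> q)"
  by (auto simp: forces_not_def ext_def)

text \<open>Unfolded, the left side only says that \<open>\<psi>\<close> holds densely below every
  extension forcing \<open>\<phi>\<close>; regularity of \<open>\<psi>\<close> turns this into truth
  at that extension.\<close>

lemma imp_iff:
  assumes "reg \<phi>" "reg \<psi>" "p \<in> P"
  shows "(\<phi> \<^bold>\<longrightarrow> \<psi>) p \<longleftrightarrow> (\<forall>q. q \<sqsubseteq> p \<longrightarrow> \<phi> q \<longrightarrow> \<psi> q)"
proof -
  have "(\<phi> \<^bold>\<longrightarrow> \<psi>) p \<longleftrightarrow> (\<forall>q. q \<sqsubseteq> p \<longrightarrow> \<not> (\<phi> q \<and> (\<forall>r. r \<sqsubseteq> q \<longrightarrow> \<not> \<psi> r)))"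
    using assms(3) by (auto simp: forces_imp_def not_iff forces_and_def ext_in)
  also have "\<dots> \<longleftrightarrow> (\<forall>q. q \<sqsubseteq> p \<longrightarrow> \<phi> q \<longrightarrow> \<psi> q)"
  proof (intro iffI allI impI)
    fix q assume *: "\<forall>q. q \<sqsubseteq> p \<longrightarrow> \<not> (\<phi> q \<and> (\<forall>r. r \<sqsubseteq> q \<longrightarrow> \<not> \<psi> r))"
      and q: "q \<sqsubseteq> p" "\<phi> q"
    then show "\<psi> q"
      using reg_mono[OF assms(1), of q] by (intro reg_dense[OF assms(2)]) (auto simp: ext_in dest: ext_trans)
  next
    fix q assume "\<forall>q. q \<sqsubseteq> p \<longrightarrow> \<phi> q \<longrightarrow> \<psi> q" "q \<sqsubseteq> p"
    then show "\<not> (\<phi> q \<and> (\<forall>r. r \<sqsubseteq> q \<longrightarrow> \<not> \<psi> r))"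
      using ext_refl ext_in(1) by blast
  qed
  finally show ?thesis .
qed

lemma iff_iff:
  "reg \<phi> \<Longrightarrow> reg \<psi> \<Longrightarrow> p \<in> P \<Longrightarrow>
   (\<phi> \<^bold>\<longleftrightarrow> \<psi>) p \<longleftrightarrow> (\<forall>q. q \<sqsubseteq> p \<longrightarrow> \<phi> q \<longleftrightarrow> \<psi> q)"
  by (auto simp: forces_iff_def forces_and_def imp_iff)

lemma or_iff:
  "reg \<phi> \<Longrightarrow> reg \<psi> \<Longrightarrow> p \<in> P \<Longrightarrow> (\<phi> \<^bold>\<or> \<psi>) p \<longleftrightarrow> dense_below p {q. \<phi> q \<or> \<psi> q}"
  by (auto simp: dense_below_ext forces_or_def not_iff forces_and_def ext_in)

lemma or_elim:
  assumes "(\<phi> \<^bold>\<or> \<psi>) p" "reg \<phi>" "reg \<psi>" "p \<in> P" "reg \<chi>"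
    and "\<And>q. q \<sqsubseteq> p \<Longrightarrow> \<phi> q \<Longrightarrow> \<chi> q" "\<And>q. q \<sqsubseteq> p \<Longrightarrow> \<psi> q \<Longrightarrow> \<chi> q"
  shows "\<chi> p"
  by (rule dense_elim[of p "{q. \<phi> q \<or> \<psi> q}"]) (use assms in \<open>auto simp: or_iff\<close>)

lemma or_intro1: "\<phi> p \<Longrightarrow> reg \<phi> \<Longrightarrow> reg \<psi> \<Longrightarrow> p \<in> P \<Longrightarrow> (\<phi> \<^bold>\<or> \<psi>) p"
  and or_intro2: "\<psi> p \<Longrightarrow> reg \<phi> \<Longrightarrow> reg \<psi> \<Longrightarrow> p \<in> P \<Longrightarrow> (\<phi> \<^bold>\<or> \<psi>) p"
  by (auto simp: or_iff intro!: dense_belowI dest: reg_mono)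

lemma all_iff: "(\<^bold>\<forall>x. \<phi> x) p \<longleftrightarrow> (\<forall>x. is_name x \<longrightarrow> \<phi> x p)"
  by (simp add: forces_all_def)

lemma ex_iff:
  assumes "p \<in> P"
  shows "(\<^bold>\<exists>x. \<phi> x) p \<longleftrightarrow> dense_below p {q. \<exists>x. is_name x \<and> \<phi> x q}"
  using assms unfolding dense_below_ext[OF assms] forces_ex_def not_iff[OF assms] all_iff
  by (simp add: not_iff ext_in) blast

lemma ex_elim:
  assumes "(\<^bold>\<exists>x. \<phi> x) p" "p \<in> P" "reg \<chi>"
    and "\<And>x q. is_name x \<Longrightarrow> q \<sqsubseteq> p \<Longrightarrow> \<phi> x q \<Longrightarrow> \<chi> q"
  shows "\<chi> p"
  by (rule dense_elim[of p "{q. \<exists>x. is_name x \<and> \<phi> x q}"]) (use assms in \<open>auto simp: ex_iff\<close>)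

lemma ex_intro: "\<phi> x p \<Longrightarrow> is_name x \<Longrightarrow> reg (\<phi> x) \<Longrightarrow> p \<in> P \<Longrightarrow> (\<^bold>\<exists>x. \<phi> x) p"
  unfolding ex_iff by (rule dense_belowI) (auto dest: reg_mono)

lemma and_iff: "(\<phi> \<^bold>\<and> \<psi>) p \<longleftrightarrow> \<phi> p \<and> \<psi> p"
  by (simp add: forces_and_def)

section \<open>Equality and membership\<close>

lemma is_name_elts: "is_name \<tau> \<Longrightarrow> (\<sigma>, s) \<in> elts \<tau> \<Longrightarrow> is_name \<sigma> \<and> s \<in> P"
  by (subst (asm) is_name_iff) auto

text \<open>Both sides unfold to the same two clauses in opposite order, up to swapping equalities
  that involve an element of \<open>\<sigma>\<close>. The induction hypothesis does the swapping, so
  induction on \<open>\<sigma>\<close> alone is enough.\<close>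

lemma eq_commute: "(\<sigma> \<^bold>= \<tau>) p \<longleftrightarrow> (\<tau> \<^bold>= \<sigma>) p"
proof (induction \<sigma> arbitrary: \<tau> p rule: pname_elts_induct)
  case (elts \<sigma>)
  have *: "(\<exists>(\<pi>\<^sub>1, s\<^sub>1)\<in>elts \<sigma>. q \<preceq> s\<^sub>1 \<and> (\<pi>\<^sub>1 \<^bold>= \<pi>) q) \<longleftrightarrow>
      (\<exists>(\<pi>\<^sub>1, s\<^sub>1)\<in>elts \<sigma>. q \<preceq> s\<^sub>1 \<and> (\<pi> \<^bold>= \<pi>\<^sub>1) q)" for \<pi> q
    using elts by fastforce
  have **: "(\<pi>\<^sub>1, s\<^sub>1) \<in> elts \<sigma> \<Longrightarrow> (\<pi>\<^sub>1 \<^bold>= \<pi>) q \<longleftrightarrow> (\<pi> \<^bold>= \<pi>\<^sub>1) q" for \<pi>\<^sub>1 s\<^sub>1 \<pi> q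
    using elts by blast
  have ***: "(\<forall>(\<pi>\<^sub>1, s\<^sub>1)\<in>elts \<sigma>. dense_below p {q. q \<preceq> s\<^sub>1 \<longrightarrow> (\<exists>(\<pi>\<^sub>2, s\<^sub>2)\<in>elts \<tau>. q \<preceq> s\<^sub>2 \<and> (\<pi>\<^sub>1 \<^bold>= \<pi>\<^sub>2) q)}) \<longleftrightarrow>
      (\<forall>(\<pi>\<^sub>1, s\<^sub>1)\<in>elts \<sigma>. dense_below p {q. q \<preceq> s\<^sub>1 \<longrightarrow> (\<exists>(\<pi>\<^sub>2, s\<^sub>2)\<in>elts \<tau>. q \<preceq> s\<^sub>2 \<and> (\<pi>\<^sub>2 \<^bold>= \<pi>\<^sub>1) q)})"
  proof (rule ball_cong[OF refl], clarify)
    fix \<pi>\<^sub>1 s\<^sub>1 assume "(\<pi>\<^sub>1, s\<^sub>1) \<in> elts \<sigma>"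
    note [simp] = **[OF this]
    show "dense_below p {q. q \<preceq> s\<^sub>1 \<longrightarrow> (\<exists>(\<pi>\<^sub>2, s\<^sub>2)\<in>elts \<tau>. q \<preceq> s\<^sub>2 \<and> (\<pi>\<^sub>1 \<^bold>= \<pi>\<^sub>2) q)} \<longleftrightarrow>
      dense_below p {q. q \<preceq> s\<^sub>1 \<longrightarrow> (\<exists>(\<pi>\<^sub>2, s\<^sub>2)\<in>elts \<tau>. q \<preceq> s\<^sub>2 \<and> (\<pi>\<^sub>2 \<^bold>= \<pi>\<^sub>1) q)}"
      by simp
  qed
  show ?case
    unfolding forces_eq_iff[of \<sigma>] forces_eq_iff[of \<tau>] * *** by (rule conj_commute)
qed

lemma mem_iff:
  "(\<sigma> \<^bold>\<in> \<tau>) p \<longleftrightarrow> dense_below p {q. \<exists>(\<pi>, s)\<in>elts \<tau>. q \<preceq> s \<and> (\<sigma> \<^bold>= \<pi>) q}"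
  by (simp add: forces_mem_def)

text \<open>This shape turns the recursive clauses for equality into membership statements.
  Extensions of a condition below \<open>s\<close> stay below \<open>s\<close>; a condition not
  below \<open>s\<close> satisfies the implication vacuously.\<close>

lemma dense_below_le_iff:
  assumes "p \<in> P" "s \<in> P"
  shows "dense_below p {q. q \<preceq> s \<longrightarrow> \<phi> q} \<longleftrightarrow>
    (\<forall>q. q \<sqsubseteq> p \<longrightarrow> q \<preceq> s \<longrightarrow> dense_below q {q. \<phi> q})"
proof
  assume "dense_below p {q. q \<preceq> s \<longrightarrow> \<phi> q}"
  then show "\<forall>q. q \<sqsubseteq> p \<longrightarrow> q \<preceq> s \<longrightarrow> dense_below q {q. \<phi> q}"
    using assms by (simp add: dense_below_ext ext_in) (meson ext_le ext_trans)
next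
  assume "\<forall>q. q \<sqsubseteq> p \<longrightarrow> q \<preceq> s \<longrightarrow> dense_below q {q. \<phi> q}"
  then show "dense_below p {q. q \<preceq> s \<longrightarrow> \<phi> q}"
    using assms by (simp add: dense_below_ext ext_in) (metis ext_in(1) ext_refl)
qed

lemma eq_iff_mem:
  assumes "is_name \<sigma>" "is_name \<tau>" "p \<in> P"
  shows "(\<sigma> \<^bold>= \<tau>) p \<longleftrightarrow>
     (\<forall>(\<pi>, s)\<in>elts \<sigma>. \<forall>q. q \<sqsubseteq> p \<longrightarrow> q \<preceq> s \<longrightarrow> (\<pi> \<^bold>\<in> \<tau>) q) \<and>
     (\<forall>(\<pi>, s)\<in>elts \<tau>. \<forall>q. q \<sqsubseteq> p \<longrightarrow> q \<preceq> s \<longrightarrow> (\<pi> \<^bold>\<in> \<sigma>) q)"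
proof -
  have *: "(\<exists>(\<pi>\<^sub>1, s\<^sub>1)\<in>elts \<sigma>. q \<preceq> s\<^sub>1 \<and> (\<pi>\<^sub>1 \<^bold>= \<pi>) q) \<longleftrightarrow>
      (\<exists>(\<pi>\<^sub>1, s\<^sub>1)\<in>elts \<sigma>. q \<preceq> s\<^sub>1 \<and> (\<pi> \<^bold>= \<pi>\<^sub>1) q)" for \<pi> q
    using eq_commute by fastforce
  show ?thesis
    unfolding forces_eq_iff[of \<sigma>] mem_iff *
    using assms is_name_elts[OF assms(1)] is_name_elts[OF assms(2)]
    by (intro arg_cong2[where f="(\<and>)"] ball_cong refl)
      (auto simp: dense_below_le_iff[OF assms(3)])
qed

lemma eqD1:
  assumes "(\<sigma> \<^bold>= \<tau>) p" "is_name \<sigma>" "is_name \<tau>" "(\<pi>, s) \<in> elts \<sigma>" "q \<sqsubseteq> p" "q \<preceq> s"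
  shows "(\<pi> \<^bold>\<in> \<tau>) q"
  using assms(1,4-) unfolding eq_iff_mem[OF assms(2,3) ext_in(2)[OF assms(5)]] by auto

lemma eqD2: "(\<tau> \<^bold>= \<sigma>) p \<Longrightarrow> is_name \<sigma> \<Longrightarrow> is_name \<tau> \<Longrightarrow> (\<pi>, s) \<in> elts \<sigma> \<Longrightarrow> q \<sqsubseteq> p \<Longrightarrow> q \<preceq> s
    \<Longrightarrow> (\<pi> \<^bold>\<in> \<tau>) q"
  using eqD1 eq_commute by blast

lemma eq_refl: "is_name \<sigma> \<Longrightarrow> p \<in> P \<Longrightarrow> (\<sigma> \<^bold>= \<sigma>) p"
proof (induction \<sigma> arbitrary: p rule: pname_elts_induct)
  case (elts \<sigma>)
  have "(\<pi> \<^bold>\<in> \<sigma>) q" if "(\<pi>, s) \<in> elts \<sigma>" "q \<sqsubseteq> p" "q \<preceq> s" for \<pi> s q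
    unfolding mem_iff using that elts is_name_elts[OF elts.prems(1) that(1)]
    by (intro dense_belowI) (auto intro!: bexI[of _ "(\<pi>, s)"] simp: ext_in dest: ext_le)
  then show ?case
    by (auto simp: eq_iff_mem elts.prems)
qed

lemma mem_elts: 
  assumes "is_name \<sigma>" "(\<pi>, s) \<in> elts \<sigma>" "p \<in> P" "p \<preceq> s"
  shows "(\<pi> \<^bold>\<in> \<sigma>) p"
  unfolding mem_iff using assms is_name_elts[OF assms(1,2)]
  by (intro dense_belowI) (auto intro!: bexI[of _ "(\<pi>, s)"] simp: ext_in eq_refl dest: ext_le)

lemma mem_elim:
  assumes "(\<sigma> \<^bold>\<in> \<tau>) p" "is_name \<tau>" "p \<in> P" "reg \<psi>"
    and "\<And>\<pi> s q. (\<pi>, s) \<in> elts \<tau> \<Longrightarrow> q \<sqsubseteq> p \<Longrightarrow> q \<preceq> s \<Longrightarrow> (\<sigma> \<^bold>= \<pi>) q \<Longrightarrow> is_name \<pi> \<Longrightarrow> s \<in> P \<Longrightarrow> \<psi> q"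
  shows "\<psi> p"
  by (rule dense_elim[OF assms(1)[unfolded mem_iff] assms(3,4)])
    (use assms is_name_elts[OF assms(2)] in auto)

lemma memI:
  assumes "(\<pi>, s) \<in> elts \<tau>" "q \<in> P" "q \<preceq> s" "(\<sigma> \<^bold>= \<pi>) q" "s \<in> P"
  shows "(\<sigma> \<^bold>\<in> \<tau>) q"
  unfolding mem_iff using assms
  by (intro dense_belowI) (auto intro!: bexI[of _ "(\<pi>, s)"] dest: ext_le reg_mono[OF reg_eq])

text \<open>An element of \<open>\<sigma>\<close> is matched with one of \<open>\<tau>\<close> and
  then with one of \<open>\<rho>\<close>, at a stronger condition each time; the induction
  hypothesis composes the two equalities.\<close>

lemma eq_trans:
  "(\<sigma> \<^bold>= \<tau>) p \<Longrightarrow> (\<tau> \<^bold>= \<rho>) p \<Longrightarrow> is_name \<sigma> \<Longrightarrow> is_name \<tau> \<Longrightarrow> is_name \<rho> \<Longrightarrow> p \<in> P \<Longrightarrow> (\<sigma> \<^bold>= \<rho>) p"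
proof (induction \<sigma> arbitrary: \<tau> \<rho> p rule: pname_elts_induct)
  case (elts \<sigma>)
  note names = elts.prems(3-5)
  have 1: "(\<pi> \<^bold>\<in> \<rho>) q" if "(\<pi>, s) \<in> elts \<sigma>" "q \<sqsubseteq> p" "q \<preceq> s" for \<pi> s q
  proof -
    have "is_name \<pi>" using is_name_elts that names by blast
    have "(\<pi> \<^bold>\<in> \<tau>) q" using eqD1[OF elts.prems(1)] names that by blast
    then show ?thesis
    proof (rule mem_elim[OF _ names(2)])
      fix \<pi>' s' r assume r: "(\<pi>', s') \<in> elts \<tau>" "r \<sqsubseteq> q" "r \<preceq> s'" "(\<pi> \<^bold>= \<pi>') r" "is_name \<pi>'"
      have "(\<pi>' \<^bold>\<in> \<rho>) r"
        using eqD1[OF elts.prems(2) names(2,3) r(1) ext_trans[OF r(2) that(2)] r(3)] .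
      then show "(\<pi> \<^bold>\<in> \<rho>) r"
      proof (rule mem_elim[OF _ names(3)])
        fix \<pi>'' s'' r' assume r': "(\<pi>'', s'') \<in> elts \<rho>" "r' \<sqsubseteq> r" "r' \<preceq> s''" "(\<pi>' \<^bold>= \<pi>'') r'" "is_name \<pi>''" "s'' \<in> P"
        then have "(\<pi> \<^bold>= \<pi>'') r'"
          using elts.IH[OF that(1), of \<pi>' r' \<pi>''] r reg_mono[OF reg_eq] \<open>is_name \<pi>\<close> ext_in by blast
        then show "(\<pi> \<^bold>\<in> \<rho>) r'"
          using r' by (intro memI) (auto simp: ext_in)
      qed (use r that in \<open>auto simp: ext_in\<close>)
    qed (use that in \<open>auto simp: ext_in\<close>)
  qed
  \<comment> \<open>In this direction the element of \<open>\<sigma>\<close> is the one found last.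
    The induction hypothesis is applied to it, and the resulting equality is reversed by
    \<open>eq_commute\<close>.\<close>
  have 2: "(\<pi> \<^bold>\<in> \<sigma>) q" if "(\<pi>, s) \<in> elts \<rho>" "q \<sqsubseteq> p" "q \<preceq> s" for \<pi> s q
  proof -
    have "is_name \<pi>" using is_name_elts that names by blast
    have "(\<pi> \<^bold>\<in> \<tau>) q" using eqD2[OF elts.prems(2)] names that by blast
    then show ?thesis
    proof (rule mem_elim[OF _ names(2)])
      fix \<pi>' s' r assume r: "(\<pi>', s') \<in> elts \<tau>" "r \<sqsubseteq> q" "r \<preceq> s'" "(\<pi> \<^bold>= \<pi>') r" "is_name \<pi>'"
      have "(\<pi>' \<^bold>\<in> \<sigma>) r"
        using eqD2[OF elts.prems(1) names(2,1) r(1) ext_trans[OF r(2) that(2)] r(3)] .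
      then show "(\<pi> \<^bold>\<in> \<sigma>) r"
      proof (rule mem_elim[OF _ names(1)])
        fix \<pi>'' s'' r' assume r': "(\<pi>'', s'') \<in> elts \<sigma>" "r' \<sqsubseteq> r" "r' \<preceq> s''" "(\<pi>' \<^bold>= \<pi>'') r'" "is_name \<pi>''" "s'' \<in> P"
        then have "(\<pi>'' \<^bold>= \<pi>) r'"
          using elts.IH[OF r'(1), of \<pi>' r' \<pi>] r reg_mono[OF reg_eq] \<open>is_name \<pi>\<close> ext_in eq_commute by blast
        then show "(\<pi> \<^bold>\<in> \<sigma>) r'"
          using r' eq_commute by (intro memI) (auto simp: ext_in)
      qed (use r that in \<open>auto simp: ext_in\<close>)
    qed (use that in \<open>auto simp: ext_in\<close>)
  qed
  show ?case
    using 1 2 elts.prems by (auto simp: eq_iff_mem)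
qed

lemma mem_cong_left:
  assumes "(x \<^bold>\<in> z) p" "(x \<^bold>= y) p" "is_name x" "is_name y" "is_name z" "p \<in> P"
  shows "(y \<^bold>\<in> z) p"
  using assms(1,5,6)
proof (rule mem_elim)
  fix \<pi> s q assume q: "(\<pi>, s) \<in> elts z" "q \<sqsubseteq> p" "q \<preceq> s" "(x \<^bold>= \<pi>) q" "is_name \<pi>" "s \<in> P"
  then have "(y \<^bold>= \<pi>) q"
    using assms eq_trans[of y x q \<pi>] eq_commute reg_mono[OF reg_eq] ext_in by blast
  then show "(y \<^bold>\<in> z) q" using q by (auto intro: memI simp: ext_in)
qed auto

lemma mem_cong_right:
  assumes "(x \<^bold>\<in> y) p" "(y \<^bold>= z) p" "is_name x" "is_name y" "is_name z" "p \<in> P"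
  shows "(x \<^bold>\<in> z) p"
  using assms(1,4,6)
proof (rule mem_elim)
  fix \<pi> s q assume q: "(\<pi>, s) \<in> elts y" "q \<sqsubseteq> p" "q \<preceq> s" "(x \<^bold>= \<pi>) q" "is_name \<pi>" "s \<in> P"
  then have "(\<pi> \<^bold>\<in> z) q"
    using eqD1[OF assms(2)] assms by blast
  then show "(x \<^bold>\<in> z) q" 
    by (rule mem_cong_left) (use assms q eq_commute in \<open>auto simp: ext_in\<close>)
qed auto

text \<open>Extensionality in the extension: \<open>u\<close> ranges over all names. Testing the
  elements of \<open>x\<close> and \<open>y\<close> is enough for the backward direction, because
  each belongs to its name below its own condition.\<close>

lemma eq_ext:
  assumes "is_name x" "is_name y" "p \<in> P"
  shows "(x \<^bold>= y) p \<longleftrightarrow> (\<forall>u q. is_name u \<longrightarrow> q \<sqsubseteq> p \<longrightarrow> (u \<^bold>\<in> x) q \<longleftrightarrow> (u \<^bold>\<in> y) q)"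
proof
  assume "(x \<^bold>= y) p"
  then show "\<forall>u q. is_name u \<longrightarrow> q \<sqsubseteq> p \<longrightarrow> (u \<^bold>\<in> x) q \<longleftrightarrow> (u \<^bold>\<in> y) q"
    using mem_cong_right[of _ x _ y] mem_cong_right[of _ y _ x] assms eq_commute reg_mono[OF reg_eq] ext_in
    by blast
next
  assume *: "\<forall>u q. is_name u \<longrightarrow> q \<sqsubseteq> p \<longrightarrow> (u \<^bold>\<in> x) q \<longleftrightarrow> (u \<^bold>\<in> y) q"
  then show "(x \<^bold>= y) p"
    unfolding eq_iff_mem[OF assms] using assms is_name_elts mem_elts ext_in by blast
qed

lemma eqI:
  assumes "is_name x" "is_name y" "p \<in> P"
    and "\<And>u q. is_name u \<Longrightarrow> q \<sqsubseteq> p \<Longrightarrow> (u \<^bold>\<in> x) q \<Longrightarrow> (u \<^bold>\<in> y) q"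
    and "\<And>u q. is_name u \<Longrightarrow> q \<sqsubseteq> p \<Longrightarrow> (u \<^bold>\<in> y) q \<Longrightarrow> (u \<^bold>\<in> x) q"
  shows "(x \<^bold>= y) p"
  using assms by (subst eq_ext) auto

lemmas eq_mono = reg_mono[OF reg_eq]
  and mem_mono = reg_mono[OF reg_mem]

text \<open>The order matters, since later steps select by position: 4 is \<open>fm_app\<close>, 5
  is \<open>fm_fun\<close>, 7 is \<open>fm_omega\<close>, 9 is \<open>fm_seq\<close> and 10 is
  \<open>fm_tree\<close>.\<close>

lemma reg_fm [simp]:
  "reg (x \<^bold>\<subseteq> y)" "reg (fm_upair x y z)" "reg (fm_pair x y z)" "reg (fm_app f x y)"
  "reg (fm_fun f a b)" "reg (fm_inductive w)" "reg (fm_omega w)" "reg (fm_finite w x)"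
  "reg (fm_seq w s)" "reg (fm_tree w T)" "reg (fm_rest T t X D)" "reg (fm_positive w E T)"
  "reg (fm_densely_diagonalizes g T)" "reg (fm_tight E)"
  by (simp_all add: fm_subset_def fm_upair_def fm_pair_def fm_app_def fm_fun_def fm_inductive_def
      fm_omega_def fm_finite_def fm_seq_def fm_tree_def fm_rest_def fm_positive_def
      fm_densely_diagonalizes_def fm_tight_def)

lemma subset_iff:
  "p \<in> P \<Longrightarrow> (x \<^bold>\<subseteq> y) p \<longleftrightarrow> (\<forall>u q. is_name u \<longrightarrow> q \<sqsubseteq> p \<longrightarrow> (u \<^bold>\<in> x) q \<longrightarrow> (u \<^bold>\<in> y) q)"
  by (auto simp: fm_subset_def all_iff imp_iff)

lemma subset_cong_right:
  assumes "(x \<^bold>\<subseteq> y) p" "(y \<^bold>= z) p" "is_name y" "is_name z" "p \<in> P"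
  shows "(x \<^bold>\<subseteq> z) p"
  using assms mem_cong_right[of _ y _ z] eq_mono[OF assms(2)] by (auto simp: subset_iff ext_in)

lemma subset_cong_left:
  assumes "(x \<^bold>\<subseteq> y) p" "(x \<^bold>= z) p" "is_name x" "is_name z" "p \<in> P"
  shows "(z \<^bold>\<subseteq> y) p"
  unfolding subset_iff[OF assms(5)]
proof (intro allI impI)
  fix u q assume u: "is_name u" "q \<sqsubseteq> p" "(u \<^bold>\<in> z) q"
  then have "(u \<^bold>\<in> x) q"
    using mem_cong_right[OF u(3), of x] eq_mono[OF assms(2) u(2)] assms by (auto simp: eq_commute ext_in)
  then show "(u \<^bold>\<in> y) q"
    using u assms(1,5) by (auto simp: subset_iff)
qed

end

text \<open>\<open>check_set\<close> has the intended elements only if the index type is large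
  enough. The size of the continuum covers countable sets of names as well as check names of
  arbitrary families of reals. The argument \<open>idx\<close> merely fixes the type
  \<open>'i\<close>.\<close>

locale forcing_index = forcing_notion P le one
  for P :: "'p set" and le (infix \<open>\<preceq>\<close> 50) and one (\<open>\<one>\<close>) +
  fixes idx :: "'i itself"
  assumes card_idx: "|UNIV :: (nat \<Rightarrow> nat) set| \<le>o |UNIV :: 'i set|"
begin

section \<open>Check names\<close>

lemma countable_ordLeq_idx:
  assumes "countable A"
  shows "|A| \<le>o |UNIV :: 'i set|"
proof -
  have "|A| \<le>o |UNIV :: nat set|"
    using assms by (auto simp: countable_def card_of_ordLeq[symmetric])
  moreover have "|UNIV :: nat set| \<le>o |UNIV :: (nat \<Rightarrow> nat) set|"
    by (rule card_of_ordLeqI[of "\<lambda>n _. n"]) (auto intro: injI dest: fun_cong)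
  ultimately show ?thesis
    using card_idx by (metis ordLeq_transitive)
qed

text \<open>The side condition under which \<open>check_set A\<close> really is a name whose
  elements are those of \<open>A\<close>.\<close>

definition small_names :: "('i, 'p) pname set \<Rightarrow> bool" where
  "small_names A \<longleftrightarrow> |A| \<le>o |UNIV :: 'i set| \<and> (\<forall>a\<in>A. is_name a)"

lemma small_namesI [simp]: "countable A \<Longrightarrow> \<forall>a\<in>A. is_name a \<Longrightarrow> small_names A"
  by (simp add: small_names_def countable_ordLeq_idx)

declare countable_finite [simp]

lemma elts_check_set: "small_names A \<Longrightarrow> elts (check_set A) = (\<lambda>\<tau>. (\<tau>, \<one>)) ` A"
  unfolding check_set_def small_names_def
  by (rule elts_name_of) (meson card_of_image ordLeq_transitive)

lemma is_name_check_set [simp]: "small_names A \<Longrightarrow> is_name (check_set A)"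
  by (subst is_name_iff) (auto simp: elts_check_set small_names_def one_in)

lemma mem_check_set:
  "small_names A \<Longrightarrow> (u \<^bold>\<in> check_set A) p \<longleftrightarrow> dense_below p {q. \<exists>a\<in>A. (u \<^bold>= a) q}"
  by (auto simp: mem_iff elts_check_set dense_below_def le_one)

lemma check_set_elim:
  assumes "(u \<^bold>\<in> check_set A) p" "small_names A" "p \<in> P" "reg \<psi>"
    and "\<And>a q. a \<in> A \<Longrightarrow> is_name a \<Longrightarrow> q \<sqsubseteq> p \<Longrightarrow> (u \<^bold>= a) q \<Longrightarrow> \<psi> q"
  shows "\<psi> p"
  by (rule dense_elim[of p "{q. \<exists>a\<in>A. (u \<^bold>= a) q}"])
    (use assms in \<open>auto simp: mem_check_set small_names_def\<close>)

lemma check_set_intro: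
  "(u \<^bold>= a) p \<Longrightarrow> a \<in> A \<Longrightarrow> small_names A \<Longrightarrow> p \<in> P \<Longrightarrow> (u \<^bold>\<in> check_set A) p"
  by (auto simp: mem_check_set intro!: dense_belowI bexI dest: eq_mono)

lemma check_set_memI: "a \<in> A \<Longrightarrow> small_names A \<Longrightarrow> p \<in> P \<Longrightarrow> (a \<^bold>\<in> check_set A) p"
  by (rule check_set_intro) (auto simp: eq_refl small_names_def)

section \<open>Unordered and ordered pairs in the extension\<close>

lemma mem_singleton:
  fixes a :: "('i, 'p) pname"
  shows "is_name a \<Longrightarrow> p \<in> P \<Longrightarrow> (u \<^bold>\<in> check_set {a}) p \<longleftrightarrow> (u \<^bold>= a) p"
  by (auto intro: check_set_intro elim!: check_set_elim)

lemma mem_upair: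
  fixes a b :: "('i, 'p) pname"
  shows "is_name a \<Longrightarrow> is_name b \<Longrightarrow> p \<in> P \<Longrightarrow> (u \<^bold>\<in> check_set {a, b}) p \<longleftrightarrow> (u \<^bold>= a \<^bold>\<or> u \<^bold>= b) p"
  by (auto simp: or_iff mem_check_set)

lemma upairI:
  fixes a b :: "('i, 'p) pname"
  assumes "is_name a" "is_name b" "p \<in> P"
  shows upairI1: "(u \<^bold>= a) p \<Longrightarrow> (u \<^bold>\<in> check_set {a, b}) p"
    and upairI2: "(u \<^bold>= b) p \<Longrightarrow> (u \<^bold>\<in> check_set {a, b}) p"
    and upair_mem1: "(a \<^bold>\<in> check_set {a, b}) p"
    and upair_mem2: "(b \<^bold>\<in> check_set {a, b}) p"
  using assms by (auto intro: check_set_intro check_set_memI)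

lemma upair_elim:
  fixes a b :: "('i, 'p) pname"
  assumes "(u \<^bold>\<in> check_set {a, b}) p" "is_name a" "is_name b" "p \<in> P" "reg \<psi>"
    and "\<And>q. q \<sqsubseteq> p \<Longrightarrow> (u \<^bold>= a) q \<Longrightarrow> \<psi> q" "\<And>q. q \<sqsubseteq> p \<Longrightarrow> (u \<^bold>= b) q \<Longrightarrow> \<psi> q"
  shows "\<psi> p"
  by (rule check_set_elim[OF assms(1)]) (use assms in auto)

lemma upair_iff:
  fixes x y z :: "('i, 'p) pname"
  assumes "is_name x" "is_name y" "is_name z" "p \<in> P"
  shows "fm_upair x y z p \<longleftrightarrow> (z \<^bold>= check_set {x, y}) p"
  using assms by (simp add: fm_upair_def all_iff iff_iff eq_ext mem_upair ext_in)

lemma upair_cong: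
  fixes x y x' y' :: "('i, 'p) pname"
  assumes "(x \<^bold>= x') p" "(y \<^bold>= y') p" "is_name x" "is_name y" "is_name x'" "is_name y'" "p \<in> P"
  shows "(check_set {x, y} \<^bold>= check_set {x', y'}) p"
proof (rule eqI)
  fix u :: "('i, 'p) pname" and q assume u: "is_name u" "q \<sqsubseteq> p"
  have e: "(v \<^bold>= x') r \<longleftrightarrow> (v \<^bold>= x) r" "(v \<^bold>= y') r \<longleftrightarrow> (v \<^bold>= y) r" if "r \<sqsubseteq> q" "is_name v" for v r
  proof -
    have "r \<sqsubseteq> p" using that u ext_trans by blast
    note m = eq_mono[OF assms(1) this] eq_mono[OF assms(2) this]
    show "(v \<^bold>= x') r \<longleftrightarrow> (v \<^bold>= x) r" "(v \<^bold>= y') r \<longleftrightarrow> (v \<^bold>= y) r"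
      using eq_trans[of v x r x'] eq_trans[of v x' r x] eq_trans[of v y r y'] eq_trans[of v y' r y]
        m that assms eq_commute[of x] eq_commute[of y] by (auto simp: ext_in)
  qed
  show "(u \<^bold>\<in> check_set {x', y'}) q" if "(u \<^bold>\<in> check_set {x, y}) q"
    by (rule upair_elim[OF that])
      (use assms u e in \<open>auto simp: ext_in intro: upairI1 upairI2\<close>)
  show "(u \<^bold>\<in> check_set {x, y}) q" if "(u \<^bold>\<in> check_set {x', y'}) q"
    by (rule upair_elim[OF that])
      (use assms u e in \<open>auto simp: ext_in intro: upairI1 upairI2\<close>)
qed (use assms in auto)

text \<open>The Kuratowski pair for arbitrary names; \<open>check_pair m n\<close> is the instance
  for two numerals.\<close>

definition opair :: "('i, 'p) pname \<Rightarrow> ('i, 'p) pname \<Rightarrow> ('i, 'p) pname" where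
  "opair x y = check_set {check_set {x}, check_set {x, y}}"

lemma is_name_opair [simp]: "is_name x \<Longrightarrow> is_name y \<Longrightarrow> is_name (opair x y)"
  by (simp add: opair_def)

lemma opair_cong:
  assumes "(x \<^bold>= x') p" "(y \<^bold>= y') p" "is_name x" "is_name y" "is_name x'" "is_name y'" "p \<in> P"
  shows "(opair x y \<^bold>= opair x' y') p"
  unfolding opair_def
  by (rule upair_cong) (use upair_cong[OF assms(1,1)] upair_cong[OF assms(1,2)] assms(3-) in simp_all)

lemma eq_trans_all:
  assumes "(a \<^bold>= b) p" "(b \<^bold>= c) q" "r \<sqsubseteq> p" "r \<sqsubseteq> q" "is_name a" "is_name b" "is_name c"
  shows "(a \<^bold>= c) r"
  using eq_trans[OF eq_mono[OF assms(1,3)] eq_mono[OF assms(2,4)] assms(5-7)] ext_in(1)[OF assms(3)] by blast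

text \<open>Allowing two names on the right covers equality with a singleton and the degenerate case
  of a pair that is forced to be a singleton.\<close>

lemma singleton_eqD:
  fixes x y y' :: "('i, 'p) pname"
  assumes "(check_set {x} \<^bold>= check_set {y, y'}) p" "is_name x" "is_name y" "is_name y'" "p \<in> P"
  shows "(x \<^bold>= y) p \<and> (x \<^bold>= y') p"
proof -
  have "(y \<^bold>\<in> check_set {x}) p"
    using mem_cong_right[OF upair_mem1, of y y' p "check_set {x}"] assms by (simp add: eq_commute)
  moreover have "(y' \<^bold>\<in> check_set {x}) p"
    using mem_cong_right[OF upair_mem2, of y y' p "check_set {x}"] assms by (simp add: eq_commute)
  ultimately show ?thesis
    using assms eq_commute by (auto simp: mem_singleton)
qed

lemma opair_eqD:
  assumes eq: "(opair x y \<^bold>= opair x' y') p"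
    and n [simp]: "is_name x" "is_name y" "is_name x'" "is_name y'" and p: "p \<in> P"
  shows "(x \<^bold>= x') p \<and> (y \<^bold>= y') p"
proof -
  have 1: "(check_set {x} \<^bold>\<in> opair x' y') p"
    by (rule mem_cong_right[OF _ eq]) (use p in \<open>simp_all add: opair_def upair_mem1\<close>)
  have 2: "(check_set {x, y} \<^bold>\<in> opair x' y') p"
    by (rule mem_cong_right[OF _ eq]) (use p in \<open>simp_all add: opair_def upair_mem2\<close>)
  have 3: "(check_set {x', y'} \<^bold>\<in> opair x y) p"
    by (rule mem_cong_right[OF _ eq[unfolded eq_commute[of "opair x y"]]])
      (use p in \<open>simp_all add: opair_def upair_mem2\<close>)
  have x: "(x \<^bold>= x') p"
    using 1[unfolded opair_def]
  proof (rule upair_elim)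
    fix q assume "q \<sqsubseteq> p" "(check_set {x} \<^bold>= check_set {x'}) q"
    then show "(x \<^bold>= x') q"
      using singleton_eqD[of x x' x' q] by (auto simp: ext_in)
  next
    fix q assume "q \<sqsubseteq> p" "(check_set {x} \<^bold>= check_set {x', y'}) q"
    then show "(x \<^bold>= x') q"
      using singleton_eqD[of x x' y' q] by (auto simp: ext_in)
  qed (use p in auto)
  \<comment> \<open>The degenerate case of the Kuratowski argument: once \<open>y\<close> equals
    \<open>x'\<close>, the set \<open>{x, y}\<close> says nothing about \<open>y'\<close>. Instead
    \<open>y'\<close> is located through the membership of \<open>{x', y'}\<close> in the first
    pair.\<close>
  have case1: "(y \<^bold>= y') q" if q: "q \<sqsubseteq> p" "(y \<^bold>= x') q" for q
    using mem_mono[OF 3 q(1), unfolded opair_def]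
  proof (rule upair_elim)
    fix r assume r: "r \<sqsubseteq> q" "(check_set {x', y'} \<^bold>= check_set {x}) r"
    then have "(x \<^bold>= x') r \<and> (x \<^bold>= y') r"
      using singleton_eqD[of x x' y' r] by (auto simp: ext_in eq_commute)
    then show "(y \<^bold>= y') r"
      using q(2) r(1) eq_trans_all[of y x' q y' r r] eq_trans_all[of x' x r y' r r] ext_refl[of r]
      by (auto simp: ext_in eq_commute)
  next
    fix r assume r: "r \<sqsubseteq> q" "(check_set {x', y'} \<^bold>= check_set {x, y}) r"
    have "(y' \<^bold>\<in> check_set {x, y}) r"
      by (rule mem_cong_right[OF _ r(2)]) (use r in \<open>auto simp: ext_in upair_mem2\<close>)
    then show "(y \<^bold>= y') r"
    proof (rule upair_elim)
      fix s assume s: "s \<sqsubseteq> r" "(y' \<^bold>= x) s"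
      have "s \<sqsubseteq> q" "s \<sqsubseteq> p" using s r q ext_trans by blast+
      have "(y \<^bold>= x) s"
        using eq_trans_all[OF q(2) x[unfolded eq_commute[of x]] \<open>s \<sqsubseteq> q\<close> \<open>s \<sqsubseteq> p\<close>] by simp
      then show "(y \<^bold>= y') s"
        using s(2)[unfolded eq_commute[of y']] eq_trans[of y x s y'] s(1) by (simp add: ext_in)
    qed (use r eq_commute in \<open>auto simp: ext_in\<close>)
  qed (use that in \<open>auto simp: ext_in\<close>)
  have "(y \<^bold>= y') p"
    using 2[unfolded opair_def]
  proof (rule upair_elim)
    fix q assume q: "q \<sqsubseteq> p" "(check_set {x, y} \<^bold>= check_set {x'}) q"
    then have "(y \<^bold>= x') q"
      using singleton_eqD[of x' x y q] by (auto simp: ext_in eq_commute)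
    then show "(y \<^bold>= y') q" using case1 q by blast
  next
    fix q assume q: "q \<sqsubseteq> p" "(check_set {x, y} \<^bold>= check_set {x', y'}) q"
    have "(y \<^bold>\<in> check_set {x', y'}) q"
      by (rule mem_cong_right[OF _ q(2)]) (use q in \<open>auto simp: ext_in upair_mem2\<close>)
    then show "(y \<^bold>= y') q"
      by (rule upair_elim) (use q case1 ext_trans in \<open>auto simp: ext_in\<close>)
  qed (use p in auto)
  with x show ?thesis ..
qed

lemma pair_iff:
  assumes n [simp]: "is_name x" "is_name y" "is_name z" and p: "p \<in> P"
  shows "fm_pair x y z p \<longleftrightarrow> (z \<^bold>= opair x y) p"
proof
  assume "fm_pair x y z p"
  then show "(z \<^bold>= opair x y) p"
    unfolding fm_pair_def
  proof (elim ex_elim, goal_cases)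
    case (5 u q v r)
    have e: "(u \<^bold>= check_set {x, x}) r" "(v \<^bold>= check_set {x, y}) r" "(z \<^bold>= check_set {u, v}) r"
      using 5 by (auto simp: and_iff upair_iff ext_in)
    show ?case
      unfolding opair_def using eq_trans[OF e(3) upair_cong[OF e(1,2)]] 5 by (simp add: ext_in)
  qed (use p in \<open>auto simp: ext_in\<close>)
next
  assume "(z \<^bold>= opair x y) p"
  then show "fm_pair x y z p"
    unfolding fm_pair_def using p
    by (intro ex_intro[of _ "check_set {x, x}"] ex_intro[of _ "check_set {x, y}"])
      (auto simp: and_iff upair_iff opair_def eq_refl)
qed

lemma app_iff:
  assumes n [simp]: "is_name f" "is_name x" "is_name y" and p: "p \<in> P"
  shows "fm_app f x y p \<longleftrightarrow> (opair x y \<^bold>\<in> f) p"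
proof
  assume "fm_app f x y p"
  then show "(opair x y \<^bold>\<in> f) p"
    unfolding fm_app_def
    by (rule ex_elim) (use p in \<open>auto simp: and_iff pair_iff ext_in intro: mem_cong_left\<close>)
next
  assume "(opair x y \<^bold>\<in> f) p"
  then show "fm_app f x y p"
    unfolding fm_app_def using p
    by (intro ex_intro[of _ "opair x y"]) (auto simp: and_iff pair_iff eq_refl)
qed

lemma app_cong:
  fixes f f' x x' y y' :: "('i, 'p) pname"
  assumes "fm_app f x y p" "(f \<^bold>= f') p" "(x \<^bold>= x') p" "(y \<^bold>= y') p" "p \<in> P"
    and n [simp]: "is_name f" "is_name x" "is_name y" "is_name f'" "is_name x'" "is_name y'"
  shows "fm_app f' x' y' p"
  using assms(1-5)
  by (auto simp: app_iff intro: mem_cong_left[OF mem_cong_right[of "opair x y" f _ f'] opair_cong])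

subsection \<open>Functions\<close>

lemma funI:
  fixes f :: "('i, 'p) pname"
  assumes n: "is_name f" "is_name a" "is_name b" and p: "p \<in> P"
    and "\<And>z q. is_name z \<Longrightarrow> q \<sqsubseteq> p \<Longrightarrow> (z \<^bold>\<in> f) q \<Longrightarrow>
      (\<^bold>\<exists>x. \<^bold>\<exists>y. x \<^bold>\<in> a \<^bold>\<and> y \<^bold>\<in> b \<^bold>\<and> fm_pair x y z) q"
    and "\<And>x q. is_name x \<Longrightarrow> q \<sqsubseteq> p \<Longrightarrow> (x \<^bold>\<in> a) q \<Longrightarrow> (\<^bold>\<exists>y. fm_app f x y) q"
    and "\<And>x y y' q. is_name x \<Longrightarrow> is_name y \<Longrightarrow> is_name y' \<Longrightarrow> q \<sqsubseteq> p \<Longrightarrow>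
      fm_app f x y q \<Longrightarrow> fm_app f x y' q \<Longrightarrow> (y \<^bold>= y') q"
  shows "fm_fun f a b p"
  using assms by (auto simp: fm_fun_def and_iff all_iff imp_iff)

lemma fun_app_ex:
  fixes f :: "('i, 'p) pname"
  assumes "fm_fun f a b p" "(x \<^bold>\<in> a) p" "is_name x" "p \<in> P"
  shows "(\<^bold>\<exists>y. fm_app f x y) p"
  using assms by (auto simp: fm_fun_def and_iff all_iff imp_iff)

lemma fun_unique:
  fixes f :: "('i, 'p) pname"
  assumes "fm_fun f a b p" "fm_app f x y p" "fm_app f x y' p" "is_name x" "is_name y" "is_name y'" "p \<in> P"
  shows "(y \<^bold>= y') p"
  using assms by (auto simp: fm_fun_def and_iff all_iff imp_iff)

lemma fun_elim:
  fixes f :: "('i, 'p) pname"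
  assumes "fm_fun f a b p" "(z \<^bold>\<in> f) p" "is_name z" "p \<in> P" "reg \<psi>"
    and "\<And>x y q. is_name x \<Longrightarrow> is_name y \<Longrightarrow> q \<sqsubseteq> p \<Longrightarrow> (x \<^bold>\<in> a) q \<Longrightarrow> (y \<^bold>\<in> b) q \<Longrightarrow> (z \<^bold>= opair x y) q \<Longrightarrow> \<psi> q"
  shows "\<psi> p"
proof -
  have "(\<^bold>\<exists>x. \<^bold>\<exists>y. x \<^bold>\<in> a \<^bold>\<and> y \<^bold>\<in> b \<^bold>\<and> fm_pair x y z) p"
    using assms(1-4) by (auto simp: fm_fun_def and_iff all_iff imp_iff)
  then show ?thesis
  proof (elim ex_elim, goal_cases)
    case (5 x q y r)
    then show ?case
      using assms(6)[of x y r] assms(3) ext_trans[of r q p] by (auto simp: and_iff pair_iff ext_in)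
  qed (use assms in \<open>auto simp: ext_in\<close>)
qed

lemma fun_value_mem:
  fixes f :: "('i, 'p) pname"
  assumes "fm_fun f a b p" "fm_app f x y p" "p \<in> P"
    and n [simp]: "is_name f" "is_name a" "is_name b" "is_name x" "is_name y"
  shows "(y \<^bold>\<in> b) p"
proof -
  have "(opair x y \<^bold>\<in> f) p"
    using assms by (simp add: app_iff)
  with assms(1) show ?thesis
  proof (rule fun_elim)
    fix x' y' q assume *: "is_name x'" "is_name y'" "q \<sqsubseteq> p" "(x' \<^bold>\<in> a) q" "(y' \<^bold>\<in> b) q" "(opair x y \<^bold>= opair x' y') q"
    then show "(y \<^bold>\<in> b) q"
      using opair_eqD[of x y x' y' q] mem_cong_left[of y' b q y] by (auto simp: ext_in eq_commute)
  qed (use assms in auto)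
qed

subsection \<open>Natural numbers\<close>

abbreviation chk :: "nat \<Rightarrow> ('i, 'p) pname" where
  "chk \<equiv> check_nat"

lemma is_name_chk [simp]: "is_name (chk n)"
  by (induction n rule: less_induct) (subst check_nat_eq, auto)

lemma chk_elim:
  assumes "(u \<^bold>\<in> chk n) p" "p \<in> P" "reg \<psi>"
    and "\<And>m q. m < n \<Longrightarrow> q \<sqsubseteq> p \<Longrightarrow> (u \<^bold>= chk m) q \<Longrightarrow> \<psi> q"
  shows "\<psi> p"
  by (rule check_set_elim[OF assms(1)[unfolded check_nat_eq[of n]]]) (use assms in auto)

lemma chk_mem: "m < n \<Longrightarrow> p \<in> P \<Longrightarrow> (chk m \<^bold>\<in> chk n) p"
  by (subst check_nat_eq[of n]) (rule check_set_memI, auto)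

text \<open>If two different numerals were forced equal, the smaller would be forced to be a member
  of itself, hence equal to a still smaller numeral, against the induction hypothesis.\<close>

lemma chk_eq_iff:
  assumes "p \<in> P"
  shows "(chk m \<^bold>= chk n) p \<longleftrightarrow> m = n"
proof
  show "(chk m \<^bold>= chk n) p \<Longrightarrow> m = n"
    using assms
  proof (induction m arbitrary: n p rule: less_induct)
    case (less m)
    consider "m < n" | "n < m" | "m = n" by linarith
    then show ?case
    proof cases
      case 1
      have "(chk m \<^bold>\<in> chk m) p"
        using mem_cong_right[OF chk_mem[OF 1]] less.prems eq_commute is_name_chk by blast
      then have False
      proof (rule chk_elim)
        fix k q assume k: "k < m" "q \<sqsubseteq> p" "(chk m \<^bold>= chk k) q"
        then show False
          using less.IH[OF k(1), of m q] eq_commute[of "chk m"] by (simp add: ext_in)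
      qed (use less in auto)
      then show ?thesis ..
    next
      case 2
      have "(chk n \<^bold>\<in> chk n) p"
        using mem_cong_right[OF chk_mem[OF 2]] less.prems is_name_chk by blast
      then have False
      proof (rule chk_elim)
        fix k q assume k: "k < n" "q \<sqsubseteq> p" "(chk n \<^bold>= chk k) q"
        then show False
          using less.IH[OF 2, of k q] by (simp add: ext_in)
      qed (use less in auto)
      then show ?thesis ..
    qed
  qed
qed (use assms in \<open>auto intro: eq_refl\<close>)

definition omega :: "('i, 'p) pname" where
  "omega = check_set (range chk)"

lemma is_name_omega [simp]: "is_name omega"
  by (auto simp: omega_def)

lemma zero_eq:
  fixes x :: "('i, 'p) pname"
  assumes "p \<in> P" "is_name x" "(\<^bold>\<forall>u. \<^bold>\<not> u \<^bold>\<in> x) p"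
  shows "(x \<^bold>= chk 0) p"
proof (rule eqI)
  fix u :: "('i, 'p) pname" and q assume "is_name u" "q \<sqsubseteq> p" "(u \<^bold>\<in> x) q"
  then show "(u \<^bold>\<in> chk 0) q" using assms by (auto simp: all_iff not_iff)
next
  fix u :: "('i, 'p) pname" and q assume "is_name u" "q \<sqsubseteq> p" "(u \<^bold>\<in> chk 0) q"
  from this(3) show "(u \<^bold>\<in> x) q"
    by (rule chk_elim) (use \<open>q \<sqsubseteq> p\<close> in \<open>auto simp: ext_in\<close>)
qed (use assms in auto)

lemma mem_chk_Suc:
  fixes u :: "('i, 'p) pname"
  assumes "is_name u" "p \<in> P"
  shows "(u \<^bold>\<in> chk (Suc n)) p \<longleftrightarrow> (u \<^bold>\<in> chk n \<^bold>\<or> u \<^bold>= chk n) p"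
proof
  assume "(u \<^bold>\<in> chk (Suc n)) p"
  then show "(u \<^bold>\<in> chk n \<^bold>\<or> u \<^bold>= chk n) p"
  proof (rule chk_elim)
    fix m q assume m: "m < Suc n" "q \<sqsubseteq> p" "(u \<^bold>= chk m) q"
    show "(u \<^bold>\<in> chk n \<^bold>\<or> u \<^bold>= chk n) q"
    proof (cases "m = n")
      case False
      then have "(u \<^bold>\<in> chk n) q"
        using m assms mem_cong_left[OF chk_mem[of m n q], of u] eq_commute by (auto simp: ext_in)
      then show ?thesis using m by (auto intro: or_intro1 simp: ext_in)
    qed (use m in \<open>auto intro: or_intro2 simp: ext_in\<close>)
  qed (use assms in auto)
next
  assume "(u \<^bold>\<in> chk n \<^bold>\<or> u \<^bold>= chk n) p"
  then show "(u \<^bold>\<in> chk (Suc n)) p"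
  proof (rule or_elim)
    fix q assume q: "q \<sqsubseteq> p" "(u \<^bold>\<in> chk n) q"
    from q(2) show "(u \<^bold>\<in> chk (Suc n)) q"
    proof (rule chk_elim)
      fix m r assume "m < n" "r \<sqsubseteq> q" "(u \<^bold>= chk m) r"
      then show "(u \<^bold>\<in> chk (Suc n)) r"
        using assms mem_cong_left[OF chk_mem[of m "Suc n" r], of u] by (auto simp: ext_in eq_commute)
    qed (use q in \<open>auto simp: ext_in\<close>)
  next
    fix q assume "q \<sqsubseteq> p" "(u \<^bold>= chk n) q"
    then show "(u \<^bold>\<in> chk (Suc n)) q"
      using assms mem_cong_left[OF chk_mem[of n "Suc n" q], of u] by (auto simp: ext_in eq_commute)
  qed (use assms in auto)
qed

lemma omega_inductive:
  assumes "p \<in> P"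
  shows "fm_inductive omega p"
proof -
  have "(\<^bold>\<forall>u. \<^bold>\<not> u \<^bold>\<in> chk 0) p"
    using assms by (auto simp: all_iff not_iff ext_in elim!: chk_elim[of _ 0 _ "\<lambda>_. False"])
  moreover have "(chk 0 \<^bold>\<in> omega) p"
    using assms by (auto simp: omega_def intro: check_set_memI)
  ultimately have "(\<^bold>\<exists>x. x \<^bold>\<in> omega \<^bold>\<and> (\<^bold>\<forall>u. \<^bold>\<not> u \<^bold>\<in> x)) p"
    using assms by (intro ex_intro[of _ "chk 0"]) (auto simp: and_iff)
  moreover have "(\<^bold>\<exists>y. y \<^bold>\<in> omega \<^bold>\<and> (\<^bold>\<forall>u. u \<^bold>\<in> y \<^bold>\<longleftrightarrow> (u \<^bold>\<in> x \<^bold>\<or> u \<^bold>= x))) q"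
    if x: "is_name x" "q \<sqsubseteq> p" "(x \<^bold>\<in> omega) q" for x q
    using x(3)[unfolded omega_def]
  proof (rule check_set_elim)
    fix a r assume a: "a \<in> range chk" and r: "r \<sqsubseteq> q" "(x \<^bold>= a) r"
    obtain n where n: "a = chk n" using a by auto
    have "(u \<^bold>\<in> x) s \<longleftrightarrow> (u \<^bold>\<in> chk n) s" "(u \<^bold>= x) s \<longleftrightarrow> (u \<^bold>= chk n) s" if "is_name u" "s \<sqsubseteq> r" for u s
      using mem_cong_right[of u x s "chk n"] mem_cong_right[of u "chk n" s x]
        eq_trans[of u x s "chk n"] eq_trans[of u "chk n" s x] eq_mono[OF r(2)] that x n eq_commute
      by (auto simp: ext_in)
    then have "(\<^bold>\<forall>u. u \<^bold>\<in> chk (Suc n) \<^bold>\<longleftrightarrow> (u \<^bold>\<in> x \<^bold>\<or> u \<^bold>= x)) r"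
      using r by (auto simp: all_iff iff_iff ext_in mem_chk_Suc or_iff dense_below_ext) (meson ext_trans)+
    moreover have "(chk (Suc n) \<^bold>\<in> omega) r"
      using r by (auto simp: omega_def ext_in intro: check_set_memI)
    ultimately show "(\<^bold>\<exists>y. y \<^bold>\<in> omega \<^bold>\<and> (\<^bold>\<forall>u. u \<^bold>\<in> y \<^bold>\<longleftrightarrow> (u \<^bold>\<in> x \<^bold>\<or> u \<^bold>= x))) r"
      using r by (intro ex_intro[of _ "chk (Suc n)"]) (auto simp: and_iff ext_in)
  qed (use x in \<open>auto simp: ext_in\<close>)
  ultimately show ?thesis
    using assms by (auto simp: fm_inductive_def and_iff all_iff imp_iff)
qed

text \<open>The induction takes place in the ground model: the empty set and the successors provided
  by \<open>fm_inductive\<close> are identified with numerals by extensionality.\<close>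

lemma chk_mem_inductive:
  fixes w :: "('i, 'p) pname"
  assumes "fm_inductive w p" "is_name w" "p \<in> P"
  shows "(chk n \<^bold>\<in> w) p"
proof (induction n)
  case 0
  have "(\<^bold>\<exists>x. x \<^bold>\<in> w \<^bold>\<and> (\<^bold>\<forall>u. \<^bold>\<not> u \<^bold>\<in> x)) p"
    using assms(1) by (simp add: fm_inductive_def and_iff)
  then show ?case
    by (rule ex_elim)
      (use assms in \<open>auto simp: and_iff ext_in intro: mem_cong_left[OF _ zero_eq]\<close>)
next
  case (Suc n)
  have "(\<^bold>\<exists>y. y \<^bold>\<in> w \<^bold>\<and> (\<^bold>\<forall>u. u \<^bold>\<in> y \<^bold>\<longleftrightarrow> (u \<^bold>\<in> chk n \<^bold>\<or> u \<^bold>= chk n))) p"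
    using assms Suc by (auto simp: fm_inductive_def and_iff all_iff imp_iff)
  then show ?case
  proof (rule ex_elim)
    fix y q
    assume y: "is_name y" "q \<sqsubseteq> p" "(y \<^bold>\<in> w \<^bold>\<and> (\<^bold>\<forall>u. u \<^bold>\<in> y \<^bold>\<longleftrightarrow> (u \<^bold>\<in> chk n \<^bold>\<or> u \<^bold>= chk n))) q"
    then have "(y \<^bold>= chk (Suc n)) q"
      by (auto simp: and_iff all_iff iff_iff ext_in eq_ext mem_chk_Suc)
    then show "(chk (Suc n) \<^bold>\<in> w) q"
      using y assms by (auto simp: and_iff ext_in intro: mem_cong_left)
  qed (use assms in auto)
qed

lemma chk_mem_omega:
  fixes w :: "('i, 'p) pname"
  assumes "fm_omega w p" "is_name w" "p \<in> P"
  shows "(chk n \<^bold>\<in> w) p"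
  using assms by (auto simp: fm_omega_def and_iff intro: chk_mem_inductive)

text \<open>There are no new natural numbers: the canonical name \<open>omega\<close> is forced to
  be inductive, so minimality places \<open>w\<close> inside it, and its members are densely equal
  to numerals.\<close>

lemma omega_elim:
  fixes w x :: "('i, 'p) pname"
  assumes "fm_omega w p" "(x \<^bold>\<in> w) p" "is_name w" "is_name x" "p \<in> P" "reg \<psi>"
    and "\<And>m q. q \<sqsubseteq> p \<Longrightarrow> (x \<^bold>= chk m) q \<Longrightarrow> \<psi> q"
  shows "\<psi> p"
proof -
  have "(w \<^bold>\<subseteq> omega) p"
    using assms omega_inductive by (auto simp: fm_omega_def and_iff all_iff imp_iff)
  then have "(x \<^bold>\<in> omega) p"
    using assms by (auto simp: subset_iff)
  then show ?thesis
    unfolding omega_def by (rule check_set_elim) (use assms in auto)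
qed

section \<open>Graphs and finite sequences\<close>

text \<open>One construction serves finite sequences, check names of reals and finite remainders of
  trees, which differ only in the relation on the ground model.\<close>

definition graph_name :: "(nat \<times> nat) set \<Rightarrow> ('i, 'p) pname" where
  "graph_name G = check_set ((\<lambda>(i, j). opair (chk i) (chk j)) ` G)"

abbreviation seq_name :: "nat list \<Rightarrow> ('i, 'p) pname" where
  "seq_name s \<equiv> graph_name (seq_graph s)"

lemma small_names_graph [simp]: "small_names ((\<lambda>(i, j). opair (chk i) (chk j)) ` G)"
  by (intro small_namesI countable_image countableI_type) auto

lemma is_name_graph [simp]: "is_name (graph_name G)"
  unfolding graph_name_def by (rule is_name_check_set) (rule small_names_graph)

lemma check_real_eq: "(check_real f :: ('i, 'p) pname) = graph_name (fun_graph f)"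
proof -
  have "range (\<lambda>n. check_pair n (f n)) = (\<lambda>(i, j). opair (chk i) (chk j)) ` fun_graph f"
    by (auto simp: fun_graph_def check_pair_def opair_def)
  then show ?thesis by (simp add: check_real_def graph_name_def)
qed

lemma pair_eq_iff:
  assumes "p \<in> P"
  shows "(opair (chk i) (chk j) \<^bold>= opair (chk k) (chk l)) p \<longleftrightarrow> i = k \<and> j = l"
  using opair_eqD[of "chk i" "chk j" "chk k" "chk l" p] assms by (auto simp: chk_eq_iff eq_refl)

lemma graph_elim:
  fixes z :: "('i, 'p) pname"
  assumes "(z \<^bold>\<in> graph_name G) p" "p \<in> P" "reg \<psi>"
    and "\<And>i j q. (i, j) \<in> G \<Longrightarrow> q \<sqsubseteq> p \<Longrightarrow> (z \<^bold>= opair (chk i) (chk j)) q \<Longrightarrow> \<psi> q"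
  shows "\<psi> p"
  by (rule check_set_elim[OF assms(1)[unfolded graph_name_def] small_names_graph])
    (use assms(2-4) in auto)

lemma graph_mem:
  assumes "(i, j) \<in> G" "p \<in> P"
  shows "(opair (chk i) (chk j) \<^bold>\<in> graph_name G) p"
  unfolding graph_name_def using assms by (intro check_set_memI small_names_graph) auto

lemma graph_memI:
  assumes "(z \<^bold>= opair (chk i) (chk j)) p" "(i, j) \<in> G" "p \<in> P"
  shows "(z \<^bold>\<in> graph_name G) p"
  unfolding graph_name_def using assms by (intro check_set_intro[OF assms(1)] small_names_graph) auto

text \<open>Membership of numeral pairs is absolute: every element carries the condition
  \<open>\<one>\<close>, and equality of pairs of numerals is settled by all conditions
  alike.\<close>

lemma graph_mem_iff:
  assumes "p \<in> P"
  shows "(opair (chk i) (chk j) \<^bold>\<in> graph_name G) p \<longleftrightarrow> (i, j) \<in> G"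
proof
  assume "(opair (chk i) (chk j) \<^bold>\<in> graph_name G) p"
  then show "(i, j) \<in> G"
    by (rule graph_elim) (use assms in \<open>auto simp: pair_eq_iff ext_in\<close>)
qed (rule graph_mem[OF _ assms])

lemma graph_subset_iff:
  assumes "p \<in> P"
  shows "(graph_name G \<^bold>\<subseteq> graph_name H) p \<longleftrightarrow> G \<subseteq> H"
proof
  assume *: "(graph_name G \<^bold>\<subseteq> graph_name H) p"
  show "G \<subseteq> H"
  proof clarify
    fix i j assume "(i, j) \<in> G"
    then have "(opair (chk i) (chk j) \<^bold>\<in> graph_name H) p"
      using * graph_mem[of i j G p] assms by (auto simp: subset_iff)
    then show "(i, j) \<in> H" using assms by (simp add: graph_mem_iff)
  qed
next
  assume GH: "G \<subseteq> H"
  show "(graph_name G \<^bold>\<subseteq> graph_name H) p"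
    unfolding subset_iff[OF assms]
  proof (intro allI impI)
    fix u :: "('i, 'p) pname" and q assume u: "is_name u" "q \<sqsubseteq> p" "(u \<^bold>\<in> graph_name G) q"
    from u(3) show "(u \<^bold>\<in> graph_name H) q"
      by (rule graph_elim) (use GH u in \<open>auto simp: ext_in intro: graph_memI\<close>)
  qed
qed

lemma graph_eq_iff:
  assumes "p \<in> P"
  shows "(graph_name G \<^bold>= graph_name H) p \<longleftrightarrow> G = H"
proof
  assume *: "(graph_name G \<^bold>= graph_name H) p"
  have "(graph_name G \<^bold>\<subseteq> graph_name H) p" "(graph_name H \<^bold>\<subseteq> graph_name G) p"
    using subset_cong_right[OF _ *] subset_cong_left[OF _ *] graph_subset_iff[OF assms, of G G] assms by simp_all
  then show "G = H" using assms by (simp add: graph_subset_iff)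
qed (use assms in \<open>simp add: eq_refl\<close>)

lemma seq_graph_subset_iff: "seq_graph s \<subseteq> seq_graph t \<longleftrightarrow> prefix s t"
proof
  assume *: "seq_graph s \<subseteq> seq_graph t"
  have i: "i < length t \<and> s ! i = t ! i" if "i < length s" for i
    using * that unfolding seq_graph_def by auto
  have "length s \<le> length t"
    using i by (meson leI nat_less_le)
  then have "s = take (length s) t"
    using i by (intro nth_equalityI) auto
  then show "prefix s t" using take_is_prefix by metis
next
  assume "prefix s t"
  then show "seq_graph s \<subseteq> seq_graph t"
    by (auto simp: seq_graph_def prefix_def nth_append)
qed

lemma seq_graph_eq_iff: "seq_graph s = seq_graph t \<longleftrightarrow> s = t"
  by (metis dual_order.refl prefix_order.antisym seq_graph_subset_iff)

text \<open>The values may be arbitrary names. With numerals as values this is the name of a finite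
  sequence; with the elements of a finite set as values it witnesses
  \<open>fm_finite\<close>.\<close>

definition enum_name :: "nat \<Rightarrow> (nat \<Rightarrow> ('i, 'p) pname) \<Rightarrow> ('i, 'p) pname" where
  "enum_name n y = check_set ((\<lambda>i. opair (chk i) (y i)) ` {..<n})"

context
  fixes n and y :: "nat \<Rightarrow> ('i, 'p) pname"
  assumes y [simp]: "\<And>i. i < n \<Longrightarrow> is_name (y i)"
begin

lemma is_name_enum [simp]: "is_name (enum_name n y)"
  unfolding enum_name_def by (rule is_name_check_set) auto

lemma enum_elim:
  fixes z :: "('i, 'p) pname"
  assumes "(z \<^bold>\<in> enum_name n y) p" "p \<in> P" "reg \<psi>"
    and "\<And>i q. i < n \<Longrightarrow> q \<sqsubseteq> p \<Longrightarrow> (z \<^bold>= opair (chk i) (y i)) q \<Longrightarrow> \<psi> q"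
  shows "\<psi> p"
  by (rule check_set_elim[OF assms(1)[unfolded enum_name_def]]) (use assms(2-4) in auto)

lemma enum_app_elim:
  assumes "fm_app (enum_name n y) x v p" "is_name x" "is_name v" "p \<in> P" "reg \<psi>"
    and "\<And>i q. i < n \<Longrightarrow> q \<sqsubseteq> p \<Longrightarrow> (x \<^bold>= chk i) q \<Longrightarrow> (v \<^bold>= y i) q \<Longrightarrow> \<psi> q"
  shows "\<psi> p"
proof (rule enum_elim)
  show "(opair x v \<^bold>\<in> enum_name n y) p"
    using assms by (simp add: app_iff)
  fix i q assume "i < n" "q \<sqsubseteq> p" "(opair x v \<^bold>= opair (chk i) (y i)) q"
  then show "\<psi> q"
    using assms(6)[of i q] opair_eqD[of x v "chk i" "y i" q] assms(2,3) by (simp add: ext_in)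
qed (use assms in auto)

lemma enum_mem: "i < n \<Longrightarrow> p \<in> P \<Longrightarrow> (opair (chk i) (y i) \<^bold>\<in> enum_name n y) p"
  unfolding enum_name_def by (rule check_set_memI) auto

lemma enum_fun:
  assumes b: "is_name b" and p: "p \<in> P" and y_b: "\<And>i. i < n \<Longrightarrow> (y i \<^bold>\<in> b) p"
  shows "fm_fun (enum_name n y) (chk n) b p"
proof (rule funI)
  fix z :: "('i, 'p) pname" and q assume z: "is_name z" "q \<sqsubseteq> p" "(z \<^bold>\<in> enum_name n y) q"
  from z(3) show "(\<^bold>\<exists>x. \<^bold>\<exists>v. x \<^bold>\<in> chk n \<^bold>\<and> v \<^bold>\<in> b \<^bold>\<and> fm_pair x v z) q"
  proof (rule enum_elim)
    fix i r assume i: "i < n" "r \<sqsubseteq> q" "(z \<^bold>= opair (chk i) (y i)) r"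
    have "(y i \<^bold>\<in> b) r"
      using mem_mono[OF y_b[OF i(1)] ext_trans[OF i(2) z(2)]] .
    then show "(\<^bold>\<exists>x. \<^bold>\<exists>v. x \<^bold>\<in> chk n \<^bold>\<and> v \<^bold>\<in> b \<^bold>\<and> fm_pair x v z) r"
      using i z ext_in[OF i(2)]
      by (intro ex_intro[of _ "chk i"] ex_intro[of _ "y i"]) (simp_all add: and_iff pair_iff chk_mem)
  qed (use z in \<open>auto simp: ext_in\<close>)
next
  fix x :: "('i, 'p) pname" and q assume x: "is_name x" "q \<sqsubseteq> p" "(x \<^bold>\<in> chk n) q"
  from x(3) show "(\<^bold>\<exists>v. fm_app (enum_name n y) x v) q"
  proof (rule chk_elim)
    fix i r assume i: "i < n" "r \<sqsubseteq> q" "(x \<^bold>= chk i) r"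
    note r = ext_in(1)[OF i(2)]
    have "(opair (chk i) (y i) \<^bold>= opair x (y i)) r"
      using i x r by (intro opair_cong) (simp_all add: eq_commute eq_refl)
    then have "(opair x (y i) \<^bold>\<in> enum_name n y) r"
      using mem_cong_left[OF enum_mem[OF i(1) r]] i x r by simp
    then show "(\<^bold>\<exists>v. fm_app (enum_name n y) x v) r"
      using i x r by (intro ex_intro[of _ "y i"]) (simp_all add: app_iff)
  qed (use x in \<open>auto simp: ext_in\<close>)
next
  fix x v v' :: "('i, 'p) pname" and q
  assume v: "is_name x" "is_name v" "is_name v'" "q \<sqsubseteq> p"
    "fm_app (enum_name n y) x v q" "fm_app (enum_name n y) x v' q"
  from v(5) show "(v \<^bold>= v') q"
  proof (rule enum_app_elim)
    fix i r assume i: "i < n" "r \<sqsubseteq> q" "(x \<^bold>= chk i) r" "(v \<^bold>= y i) r"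
    from reg_mono[OF reg_fm(4) v(6) i(2)] show "(v \<^bold>= v') r"
    proof (rule enum_app_elim)
      fix j s assume j: "j < n" "s \<sqsubseteq> r" "(x \<^bold>= chk j) s" "(v' \<^bold>= y j) s"
      note e = eq_mono[OF i(3) j(2)] eq_mono[OF i(4) j(2)] ext_in(1)[OF j(2)]
      have "(chk i \<^bold>= chk j) s"
        using eq_trans[of "chk i" x s "chk j"] e j v by (simp add: eq_commute)
      then have "i = j" using e by (simp add: chk_eq_iff)
      then show "(v \<^bold>= v') s"
        using eq_trans[of v "y i" s v'] e j v i by (simp add: eq_commute)
    qed (use v i in \<open>auto simp: ext_in\<close>)
  qed (use v in \<open>auto simp: ext_in\<close>)
qed (use b p in auto)

end

lemma seq_name_eq_enum: "seq_name s = enum_name (length s) (\<lambda>i. chk (s ! i))"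
proof -
  have "(\<lambda>(i, j). opair (chk i) (chk j)) ` seq_graph s = (\<lambda>i. opair (chk i) (chk (s ! i))) ` {..<length s}"
    by (auto simp: seq_graph_def)
  then show ?thesis by (simp add: graph_name_def enum_name_def)
qed

lemma fm_seq_seq_name:
  assumes "fm_omega w p" "is_name w" "p \<in> P"
  shows "fm_seq w (seq_name s) p"
proof -
  have "fm_fun (seq_name s) (chk (length s)) w p"
    unfolding seq_name_eq_enum using assms by (intro enum_fun) (simp_all add: chk_mem_omega)
  then show ?thesis
    unfolding fm_seq_def using assms
    by (intro ex_intro[of _ "chk (length s)"]) (simp_all add: and_iff chk_mem_omega)
qed

text \<open>Each induction step evaluates \<open>s\<close> at one more numeral, decides that value
  as a member of \<omega>, and appends it to \<open>u\<close>. Regularity of \<open>\<psi>\<close>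
  permits the finitely many passages to extensions.\<close>

lemma fun_initial_values:
  fixes s a w :: "('i, 'p) pname"
  assumes w: "fm_omega w p" and f: "fm_fun s a w p"
    and n [simp]: "is_name w" "is_name s" "is_name a" and p: "p \<in> P" and \<psi>: "reg \<psi>"
    and a: "\<And>i. i < l \<Longrightarrow> (chk i \<^bold>\<in> a) p"
    and hyp: "\<And>u q. length u = l \<Longrightarrow> q \<sqsubseteq> p \<Longrightarrow>
      (\<And>i. i < l \<Longrightarrow> (opair (chk i) (chk (u ! i)) \<^bold>\<in> s) q) \<Longrightarrow> \<psi> q"
  shows "\<psi> p"
  using a hyp
proof (induction l)
  case 0
  then show ?case using p by auto
next
  case (Suc l)
  show ?case
  proof (rule Suc.IH)
    fix u q assume u: "length u = l" "q \<sqsubseteq> p" "\<And>i. i < l \<Longrightarrow> (opair (chk i) (chk (u ! i)) \<^bold>\<in> s) q"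
    note wq = reg_mono[OF reg_fm(7) w u(2)]
    note fq = reg_mono[OF reg_fm(5) f u(2)]
    have "(chk l \<^bold>\<in> a) q"
      using mem_mono[OF Suc.prems(1) u(2)] by simp
    then have "(\<^bold>\<exists>v. fm_app s (chk l) v) q"
      using fun_app_ex[OF fq] u(2) by (simp add: ext_in)
    then show "\<psi> q"
    proof (rule ex_elim)
      fix v r assume v: "is_name v" "r \<sqsubseteq> q" "fm_app s (chk l) v r"
      have "(v \<^bold>\<in> w) r"
        using fun_value_mem[OF reg_mono[OF reg_fm(5) fq v(2)] v(3)] v by (simp add: ext_in)
      with reg_mono[OF reg_fm(7) wq v(2)] show "\<psi> r"
      proof (rule omega_elim)
        fix k t assume t: "t \<sqsubseteq> r" "(v \<^bold>= chk k) t"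
        note tP = ext_in(1)[OF t(1)]
        have tq: "t \<sqsubseteq> q" using ext_trans[OF t(1) v(2)] .
        have l: "(opair (chk l) (chk k) \<^bold>\<in> s) t"
          using app_cong[OF reg_mono[OF reg_fm(4) v(3) t(1)] _ _ t(2), of s "chk l"] tP v
          by (simp add: eq_refl app_iff)
        show "\<psi> t"
        proof (rule Suc.prems(2))
          show "length (u @ [k]) = Suc l" using u by simp
          show "t \<sqsubseteq> p" using tq u(2) by (rule ext_trans)
          fix i assume "i < Suc l"
          then show "(opair (chk i) (chk ((u @ [k]) ! i)) \<^bold>\<in> s) t"
            using l u mem_mono[OF u(3) tq] by (cases "i = l") (simp_all add: nth_append)
        qed
      qed (use v \<psi> in \<open>auto simp: ext_in\<close>)
    qed (use u \<psi> in \<open>auto simp: ext_in\<close>)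
  qed (use Suc.prems in auto)
qed

text \<open>There are no new finite sequences: the length is decided to be some \<open>m\<close>,
  then the \<open>m\<close> values are decided. Functionality of \<open>s\<close> excludes any
  further pairs, so \<open>s\<close> equals the name of the list of values.\<close>

lemma seq_elim:
  fixes s w :: "('i, 'p) pname"
  assumes w: "fm_omega w p" and s: "fm_seq w s p"
    and n [simp]: "is_name w" "is_name s" and p: "p \<in> P" and \<psi>: "reg \<psi>"
    and hyp: "\<And>u q. q \<sqsubseteq> p \<Longrightarrow> (s \<^bold>= seq_name u) q \<Longrightarrow> \<psi> q"
  shows "\<psi> p"
  using s[unfolded fm_seq_def]
proof (rule ex_elim)
  fix a q assume a: "is_name a" "q \<sqsubseteq> p" "(a \<^bold>\<in> w \<^bold>\<and> fm_fun s a w) q"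
  then have aw: "(a \<^bold>\<in> w) q" and f: "fm_fun s a w q" by (simp_all add: and_iff)
  note wq = reg_mono[OF reg_fm(7) w a(2)]
  from wq aw show "\<psi> q"
  proof (rule omega_elim)
    fix m r assume r: "r \<sqsubseteq> q" "(a \<^bold>= chk m) r"
    note rP = ext_in(1)[OF r(1)]
    note wr = reg_mono[OF reg_fm(7) wq r(1)]
    note fr = reg_mono[OF reg_fm(5) f r(1)]
    from wr fr show "\<psi> r"
    proof (rule fun_initial_values)
      fix i assume "i < m"
      then show "(chk i \<^bold>\<in> a) r"
        using mem_cong_right[OF chk_mem[of i m r]] r rP a(1) by (simp add: eq_commute)
    next
      fix u t
      assume u: "length u = m" "t \<sqsubseteq> r" "\<And>i. i < m \<Longrightarrow> (opair (chk i) (chk (u ! i)) \<^bold>\<in> s) t"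
      note tP = ext_in(1)[OF u(2)]
      note ft = reg_mono[OF reg_fm(5) fr u(2)]
      have "(s \<^bold>= seq_name u) t"
      proof (rule eqI)
        fix z :: "('i, 'p) pname" and x assume z: "is_name z" "x \<sqsubseteq> t" "(z \<^bold>\<in> s) x"
        note fx = reg_mono[OF reg_fm(5) ft z(2)]
        from fx z(3) show "(z \<^bold>\<in> seq_name u) x"
        proof (rule fun_elim)
          fix i v y assume y: "is_name i" "is_name v" "y \<sqsubseteq> x" "(i \<^bold>\<in> a) y" "(v \<^bold>\<in> w) y" "(z \<^bold>= opair i v) y"
          have yt: "y \<sqsubseteq> t" using ext_trans[OF y(3) z(2)] .
          \<comment> \<open>The first coordinate of an arbitrary element of \<open>s\<close> is
            thereby one of the \<open>m\<close> arguments whose values are already decided.\<close>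
          have "(i \<^bold>\<in> chk m) y"
            using mem_cong_right[OF y(4) eq_mono[OF r(2) ext_trans[OF yt u(2)]]] y a(1) by (simp add: ext_in)
          then show "(z \<^bold>\<in> seq_name u) y"
          proof (rule chk_elim)
            fix j c assume c: "j < m" "c \<sqsubseteq> y" "(i \<^bold>= chk j) c"
            note cP = ext_in(1)[OF c(2)]
            have ct: "c \<sqsubseteq> t" using ext_trans[OF c(2) yt] .
            have zc: "(z \<^bold>= opair i v) c" using eq_mono[OF y(6) c(2)] .
            have zs: "(z \<^bold>\<in> s) c" using mem_mono[OF z(3) ext_trans[OF c(2) y(3)]] .
            have "fm_app s i v c"
              using mem_cong_left[OF zs zc] z y cP by (simp add: app_iff)
            moreover have "fm_app s i (chk (u ! j)) c"
              using app_cong[of s "chk j" "chk (u ! j)" c s i "chk (u ! j)"] mem_mono[OF u(3)[OF c(1)] ct] c y cP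
              by (simp add: app_iff eq_refl eq_commute)
            ultimately have "(v \<^bold>= chk (u ! j)) c"
              using fun_unique[OF reg_mono[OF reg_fm(5) ft ct]] y cP by simp
            then have "(opair i v \<^bold>= opair (chk j) (chk (u ! j))) c"
              using opair_cong[OF c(3)] y cP by simp
            then have "(z \<^bold>= opair (chk j) (chk (u ! j))) c"
              using eq_trans[OF zc] z y cP by simp
            then show "(z \<^bold>\<in> seq_name u) c"
              by (rule graph_memI) (use c u cP in \<open>auto simp: seq_graph_def\<close>)
          qed (use y in \<open>auto simp: ext_in\<close>)
        qed (use z in \<open>auto simp: ext_in\<close>)
      next
        fix z :: "('i, 'p) pname" and x assume z: "is_name z" "x \<sqsubseteq> t" "(z \<^bold>\<in> seq_name u) x"
        from z(3) show "(z \<^bold>\<in> s) x"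
        proof (rule graph_elim)
          fix i j y assume y: "(i, j) \<in> seq_graph u" "y \<sqsubseteq> x" "(z \<^bold>= opair (chk i) (chk j)) y"
          then have "(opair (chk i) (chk j) \<^bold>\<in> s) y"
            using mem_mono[OF u(3)[of i] ext_trans[OF y(2) z(2)]] u(1) by (auto simp: seq_graph_def)
          then show "(z \<^bold>\<in> s) y"
            by (rule mem_cong_left) (use y z in \<open>auto simp: ext_in eq_commute\<close>)
        qed (use z in \<open>auto simp: ext_in\<close>)
      qed (use tP in auto)
      then show "\<psi> t"
        by (intro hyp[of t u]) (use u r a ext_trans in blast)+
    qed (use a rP \<psi> in auto)
  qed (use a \<psi> in \<open>auto simp: ext_in\<close>)
qed (use p \<psi> in auto)

text \<open>A bijection from \<open>n\<close> onto \<open>A\<close> in the ground model supplies the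
  enumeration. The assumption \<open>inj\<close> makes it forced injective: different names could
  otherwise be forced equal by some extension.\<close>

lemma finite_check_set:
  fixes w :: "('i, 'p) pname"
  assumes w: "fm_omega w p" "is_name w" and p: "p \<in> P"
    and A: "finite A" "\<And>a. a \<in> A \<Longrightarrow> is_name a"
    and inj: "\<And>a b q. a \<in> A \<Longrightarrow> b \<in> A \<Longrightarrow> q \<sqsubseteq> p \<Longrightarrow> (a \<^bold>= b) q \<Longrightarrow> a = b"
  shows "fm_finite w (check_set A) p"
proof -
  define n where "n = card A"
  obtain y where y: "bij_betw y {0..<n} A"
    using ex_bij_betw_nat_finite[OF A(1)] unfolding n_def by blast
  have yA: "y i \<in> A" if "i < n" for i
    using y that by (auto simp: bij_betw_def)
  then have yn [simp]: "is_name (y i)" if "i < n" for i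
    using A(2) that by blast
  have sA: "small_names A" using A by simp
  let ?f = "enum_name n y"
  have "fm_fun ?f (chk n) (check_set A) p"
    using sA p by (intro enum_fun) (simp_all add: check_set_memI yA)
  moreover have "(\<^bold>\<forall>v. v \<^bold>\<in> check_set A \<^bold>\<longrightarrow> (\<^bold>\<exists>m. fm_app ?f m v)) p"
  proof -
    have "(\<^bold>\<exists>m. fm_app ?f m v) q" if v: "is_name v" "q \<sqsubseteq> p" "(v \<^bold>\<in> check_set A) q" for v q
      using v(3)
    proof (rule check_set_elim)
      fix a r assume a: "a \<in> A" "is_name a" "r \<sqsubseteq> q" "(v \<^bold>= a) r"
      note r = ext_in(1)[OF a(3)]
      obtain i where i: "i < n" "a = y i"
        using y a(1) by (auto simp: bij_betw_def)
      have "fm_app ?f (chk i) (y i) r"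
        using i r by (simp add: app_iff enum_mem)
      then have "fm_app ?f (chk i) v r"
        by (rule app_cong) (use i a v r in \<open>auto simp: eq_refl eq_commute\<close>)
      then show "(\<^bold>\<exists>m. fm_app ?f m v) r"
        using r by (intro ex_intro[of _ "chk i"]) auto
    qed (use sA v in \<open>auto simp: ext_in\<close>)
    then show ?thesis using p by (simp add: all_iff imp_iff)
  qed
  moreover have "(\<^bold>\<forall>m. \<^bold>\<forall>m'. \<^bold>\<forall>v. fm_app ?f m v \<^bold>\<and> fm_app ?f m' v \<^bold>\<longrightarrow> m \<^bold>= m') p"
  proof -
    have "(m \<^bold>= m') q" if v: "is_name m" "is_name m'" "is_name v" "q \<sqsubseteq> p" "fm_app ?f m v q" "fm_app ?f m' v q"
      for m m' v q
    proof (rule enum_app_elim[OF yn v(5)])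
      fix i r assume i: "i < n" "r \<sqsubseteq> q" "(m \<^bold>= chk i) r" "(v \<^bold>= y i) r"
      show "(m \<^bold>= m') r"
      proof (rule enum_app_elim[OF yn reg_mono[OF reg_fm(4) v(6) i(2)]])
        fix j t assume j: "j < n" "t \<sqsubseteq> r" "(m' \<^bold>= chk j) t" "(v \<^bold>= y j) t"
        note t = ext_in(1)[OF j(2)]
        note e = eq_mono[OF i(3) j(2)] eq_mono[OF i(4) j(2)]
        have "(y i \<^bold>= y j) t"
          using eq_trans[of "y i" v t "y j"] e j v i t by (simp add: eq_commute)
        then have "y i = y j"
          using inj[of "y i" "y j" t] yA i j ext_trans[OF j(2) ext_trans[OF i(2) v(4)]] by blast
        then have "i = j"
          using y i j by (auto simp: bij_betw_def inj_on_def)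
        then show "(m \<^bold>= m') t"
          using eq_trans[of m "chk i" t m'] e j v t by (simp add: eq_commute)
      qed (use v i in \<open>auto simp: ext_in\<close>)
    qed (use v in \<open>auto simp: ext_in\<close>)
    then show ?thesis using p by (simp add: all_iff imp_iff and_iff)
  qed
  ultimately show ?thesis
    unfolding fm_finite_def using p chk_mem_omega[OF w p, of n]
    by (intro ex_intro[of _ "chk n"] ex_intro[of _ ?f]) (simp_all add: and_iff)
qed

section \<open>Trees of possible nodes\<close>

lemma small_names_family [simp]: "small_names (check_real ` X :: ('i, 'p) pname set)"
proof -
  have "|check_real ` X :: ('i, 'p) pname set| \<le>o |UNIV :: (nat \<Rightarrow> nat) set|"
    by (rule ordLeq_transitive[OF card_of_mono1[OF image_mono[OF subset_UNIV]] card_of_image])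
  then show ?thesis
    using card_idx by (auto simp: small_names_def check_real_eq intro: ordLeq_transitive)
qed

lemma is_name_family [simp]: "is_name (check_family X :: ('i, 'p) pname)"
  unfolding check_family_def by (rule is_name_check_set) (rule small_names_family)

lemma family_elim:
  fixes f :: "('i, 'p) pname"
  assumes "(f \<^bold>\<in> check_family X) p" "p \<in> P" "reg \<psi>"
    and "\<And>h q. h \<in> X \<Longrightarrow> q \<sqsubseteq> p \<Longrightarrow> (f \<^bold>= graph_name (fun_graph h)) q \<Longrightarrow> \<psi> q"
  shows "\<psi> p"
  by (rule check_set_elim[OF assms(1)[unfolded check_family_def] small_names_family])
    (use assms(2-4) in \<open>auto simp: check_real_eq\<close>)

lemma family_mem: "h \<in> X \<Longrightarrow> p \<in> P \<Longrightarrow> (graph_name (fun_graph h) \<^bold>\<in> check_family X) p"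
  unfolding check_family_def by (rule check_set_memI) (auto simp: check_real_eq[symmetric])

lemma family_subset:
  assumes "X \<subseteq> Y" "p \<in> P"
  shows "((check_family X :: ('i, 'p) pname) \<^bold>\<subseteq> check_family Y) p"
  unfolding subset_iff[OF assms(2)]
proof (intro allI impI)
  fix u :: "('i, 'p) pname" and q assume u: "is_name u" "q \<sqsubseteq> p" "(u \<^bold>\<in> check_family X) q"
  from u(3) show "(u \<^bold>\<in> check_family Y) q"
  proof (rule family_elim)
    fix h r assume h: "h \<in> X" "r \<sqsubseteq> q" "(u \<^bold>= graph_name (fun_graph h)) r"
    then show "(u \<^bold>\<in> check_family Y) r"
      using mem_cong_left[OF family_mem[of h Y r]] assms u by (auto simp: ext_in eq_commute)
  qed (use u in \<open>auto simp: ext_in\<close>)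
qed

lemma finite_family:
  fixes w :: "('i, 'p) pname"
  assumes "fm_omega w p" "is_name w" "p \<in> P" "finite X"
  shows "fm_finite w (check_family X) p"
  unfolding check_family_def using assms
  by (intro finite_check_set) (auto simp: check_real_eq graph_eq_iff ext_in)

lemma finite_graph:
  fixes w :: "('i, 'p) pname"
  assumes "fm_omega w p" "is_name w" "p \<in> P" "finite G"
  shows "fm_finite w (graph_name G) p"
  unfolding graph_name_def using assms
  by (intro finite_check_set) (auto simp: pair_eq_iff ext_in)

text \<open>One extension is taken per formula, and earlier decisions persist by regularity.
  Finiteness of \<open>A\<close> is essential, since infinitely many extensions need not have a
  lower bound.\<close>

lemma decide:
  assumes "finite A" "\<And>a. a \<in> A \<Longrightarrow> reg (\<phi> a)" "p \<in> P"
  shows "\<exists>q. q \<sqsubseteq> p \<and> (\<forall>a\<in>A. \<phi> a q \<or> (\<^bold>\<not> \<phi> a) q)"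
  using assms
proof (induction A rule: finite_induct)
  case empty
  then show ?case using ext_refl by blast
next
  case (insert a A)
  then obtain q where q: "q \<sqsubseteq> p" "\<forall>a\<in>A. \<phi> a q \<or> (\<^bold>\<not> \<phi> a) q"
    by auto
  obtain r where r: "r \<sqsubseteq> q" "\<phi> a r \<or> (\<^bold>\<not> \<phi> a) r"
  proof (cases "(\<^bold>\<not> \<phi> a) q")
    case True
    then show ?thesis using that[of q] q ext_refl[of q] by (auto simp: ext_in)
  next
    case False
    then show ?thesis using that q(1) by (auto simp: not_iff ext_in)
  qed
  have "\<phi> b r \<or> (\<^bold>\<not> \<phi> b) r" if "b \<in> A" for b
    using q(2) that reg_mono[OF _ _ r(1), of "\<phi> b"] reg_mono[OF _ _ r(1), of "\<^bold>\<not> \<phi> b"] insert.prems(1)[of b]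
    by auto
  then show ?case using r q ext_trans by blast
qed

text \<open>The value of \<open>F\<close> at \<open>m\<close> is quantified away, so that one
  predicate of conditions speaks about the \<open>m\<close>-th tree without choosing a name for
  it.\<close>

definition tree_mem :: "('i, 'p) pname \<Rightarrow> nat \<Rightarrow> nat list \<Rightarrow> 'p \<Rightarrow> bool" where
  "tree_mem F m s = (\<^bold>\<exists>T. fm_app F (chk m) T \<^bold>\<and> seq_name s \<^bold>\<in> T)"

lemma reg_tree_mem [simp]: "reg (tree_mem F m s)"
  by (simp add: tree_mem_def)

lemma tree_memI:
  "fm_app F (chk m) T p \<Longrightarrow> (seq_name s \<^bold>\<in> T) p \<Longrightarrow> is_name T \<Longrightarrow> p \<in> P \<Longrightarrow> tree_mem F m s p"
  unfolding tree_mem_def by (rule ex_intro[of _ T]) (simp_all add: and_iff)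

definition possible_tree :: "('i, 'p) pname \<Rightarrow> nat \<Rightarrow> 'p \<Rightarrow> nat list set" where
  "possible_tree F m p = {s. \<exists>q. q \<sqsubseteq> p \<and> tree_mem F m s q}"

section \<open>Trees in the extension seen from the ground model\<close>

lemma positive_treeD:
  assumes "fm_positive w E T p"
  shows "fm_tree w T p"
    and "(\<^bold>\<not> (\<^bold>\<exists>t. \<^bold>\<exists>X. t \<^bold>\<in> T \<^bold>\<and> fm_finite w X \<^bold>\<and> X \<^bold>\<subseteq> E \<^bold>\<and>
           (\<^bold>\<exists>D. fm_rest T t X D \<^bold>\<and> fm_finite w D))) p"
  using assms by (simp_all add: fm_positive_def and_iff)

lemma tree_seq:
  assumes "fm_tree w T p" "(t \<^bold>\<in> T) p" "is_name t" "p \<in> P"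
  shows "fm_seq w t p"
proof -
  have "(t \<^bold>\<in> T \<^bold>\<longrightarrow> fm_seq w t) p"
    using assms(1,3) by (simp add: fm_tree_def and_iff all_iff)
  then show ?thesis using assms by (simp add: imp_iff)
qed

lemma tree_prefix:
  fixes T w :: "('i, 'p) pname"
  assumes "fm_tree w T p" "(seq_name t \<^bold>\<in> T) p" "prefix s t" "fm_omega w p" "is_name w" "p \<in> P"
  shows "(seq_name s \<^bold>\<in> T) p"
proof -
  have *: "(\<^bold>\<forall>t. \<^bold>\<forall>s. t \<^bold>\<in> T \<^bold>\<and> fm_seq w s \<^bold>\<and> s \<^bold>\<subseteq> t \<^bold>\<longrightarrow> s \<^bold>\<in> T) p"
    using assms(1) by (simp add: fm_tree_def and_iff)
  have "(seq_name t \<^bold>\<in> T \<^bold>\<and> fm_seq w (seq_name s) \<^bold>\<and> seq_name s \<^bold>\<subseteq> seq_name t \<^bold>\<longrightarrow> seq_name s \<^bold>\<in> T) p"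
    using * unfolding all_iff by simp
  then show ?thesis
    using assms fm_seq_seq_name[of w p s] by (simp add: imp_iff and_iff graph_subset_iff seq_graph_subset_iff)
qed

text \<open>The conclusion is a ground model statement, reached by eliminating into constant
  predicates: the proper extension of \<open>t\<close> in \<open>T\<close> is a name, which a
  further condition identifies with a list.\<close>

lemma tree_pruned:
  fixes T w :: "('i, 'p) pname"
  assumes T: "fm_tree w T p" "(seq_name t \<^bold>\<in> T) p" "fm_omega w p" and n [simp]: "is_name w" "is_name T"
    and p: "p \<in> P"
  shows "\<exists>s q. strict_prefix t s \<and> q \<sqsubseteq> p \<and> (seq_name s \<^bold>\<in> T) q"
proof -
  let ?C = "\<exists>s q. strict_prefix t s \<and> q \<sqsubseteq> p \<and> (seq_name s \<^bold>\<in> T) q"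
  have "(\<^bold>\<exists>s. s \<^bold>\<in> T \<^bold>\<and> seq_name t \<^bold>\<subseteq> s \<^bold>\<and> \<^bold>\<not> seq_name t \<^bold>= s) p"
    using T p by (simp add: fm_tree_def and_iff all_iff imp_iff)
  then show ?C
  proof (rule ex_elim[where \<chi> = "\<lambda>_. ?C"])
    fix s q assume s: "is_name s" "q \<sqsubseteq> p" "(s \<^bold>\<in> T \<^bold>\<and> seq_name t \<^bold>\<subseteq> s \<^bold>\<and> \<^bold>\<not> seq_name t \<^bold>= s) q"
    note q = ext_in(1)[OF s(2)]
    have "fm_seq w s q"
      using tree_seq[OF reg_mono[OF reg_fm(10) T(1) s(2)]] s q by (simp add: and_iff)
    with reg_mono[OF reg_fm(7) T(3) s(2)] show ?C
    proof (rule seq_elim[where \<psi> = "\<lambda>_. ?C"])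
      fix u r assume u: "r \<sqsubseteq> q" "(s \<^bold>= seq_name u) r"
      note r = ext_in(1)[OF u(1)]
      have s': "(s \<^bold>\<in> T) r" "(seq_name t \<^bold>\<subseteq> s) r" "(\<^bold>\<not> seq_name t \<^bold>= s) r"
        using s(3) u(1) by (auto simp: and_iff intro: reg_mono)
      have "(seq_name u \<^bold>\<in> T) r"
        using mem_cong_left[OF s'(1) u(2)] s r by simp
      moreover have "prefix t u"
        using subset_cong_right[OF s'(2) u(2)] s r by (simp add: graph_subset_iff seq_graph_subset_iff)
      moreover have "t \<noteq> u"
        using s'(3) u(2) r ext_refl[of r] by (auto simp: not_iff eq_commute)
      ultimately show ?C
        using ext_trans[OF u(1) s(2)] by (auto simp: strict_prefix_def)
    qed (use s q in auto)
  qed (use p in auto)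
qed

lemma possible_tree_cases:
  assumes "s \<in> possible_tree F m p"
  obtains T q where "is_name T" "q \<sqsubseteq> p" "fm_app F (chk m) T q" "(seq_name s \<^bold>\<in> T) q"
proof -
  obtain q where q: "q \<sqsubseteq> p" "tree_mem F m s q"
    using assms by (auto simp: possible_tree_def)
  let ?C = "\<exists>T q. is_name T \<and> q \<sqsubseteq> p \<and> fm_app F (chk m) T q \<and> (seq_name s \<^bold>\<in> T) q"
  from q(2) have ?C
    unfolding tree_mem_def
  proof (rule ex_elim[where \<chi> = "\<lambda>_. ?C"])
    fix T r assume "is_name T" "r \<sqsubseteq> q" "(fm_app F (chk m) T \<^bold>\<and> seq_name s \<^bold>\<in> T) r"
    then show ?C using ext_trans[OF _ q(1)] unfolding and_iff by blast
  qed (use q in \<open>auto simp: ext_in\<close>)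
  then show ?thesis using that by blast
qed

lemma possible_treeI:
  "fm_app F (chk m) T q \<Longrightarrow> (seq_name s \<^bold>\<in> T) q \<Longrightarrow> is_name T \<Longrightarrow> q \<sqsubseteq> p \<Longrightarrow> s \<in> possible_tree F m p"
  unfolding possible_tree_def using tree_memI ext_in by blast

text \<open>
  A condition putting \<open>t\<close> into the tree decides which points of the finite set \<open>D\<close> are realized
  below \<open>t\<close>, so that the remainder it forces is a check name.
\<close>

lemma rest_decided:
  fixes T w :: "('i, 'p) pname" and X :: "(nat \<Rightarrow> nat) set"
  assumes w: "fm_omega w p" and T: "fm_tree w T p" and n [simp]: "is_name w" "is_name T"
    and p: "p \<in> P"
    and S: "\<And>s q. q \<sqsubseteq> p \<Longrightarrow> (seq_name s \<^bold>\<in> T) q \<Longrightarrow> s \<in> S"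
    and fin: "finite (\<Union>(seq_graph ` subtree_at S t) - \<Union>(fun_graph ` X))"
  shows "\<exists>q G. q \<sqsubseteq> p \<and> finite G \<and> fm_rest T (seq_name t) (check_family X) (graph_name G) q"
proof -
  define D where "D = \<Union>(seq_graph ` subtree_at S t) - \<Union>(fun_graph ` X)"
  define below where "below z = (\<^bold>\<exists>s. s \<^bold>\<in> T \<^bold>\<and> (s \<^bold>\<subseteq> seq_name t \<^bold>\<or> seq_name t \<^bold>\<subseteq> s) \<^bold>\<and> z \<^bold>\<in> s)"
    for z :: "('i, 'p) pname"
  define covered where "covered z = (\<^bold>\<exists>f. f \<^bold>\<in> check_family X \<^bold>\<and> z \<^bold>\<in> f)" for z :: "('i, 'p) pname"
  have [simp]: "reg (below z)" "reg (covered z)" for z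
    by (simp_all add: below_def covered_def)
  \<comment> \<open>A member \<open>z\<close> of a name is only forced equal to a pair of numerals,
    so what is decided about that pair must be transported to \<open>z\<close> and back.\<close>
  have below_cong: "below z' q" if z: "below z q" "(z \<^bold>= z') q" "is_name z" "is_name z'" "q \<in> P" for z z' q
    using z(1) unfolding below_def
  proof (rule ex_elim)
    fix s r assume s: "is_name s" "r \<sqsubseteq> q" "(s \<^bold>\<in> T \<^bold>\<and> (s \<^bold>\<subseteq> seq_name t \<^bold>\<or> seq_name t \<^bold>\<subseteq> s) \<^bold>\<and> z \<^bold>\<in> s) r"
    have "(z' \<^bold>\<in> s) r"
      using mem_cong_left[of z s r z'] eq_mono[OF z(2) s(2)] s z by (simp add: and_iff ext_in)
    then show "(\<^bold>\<exists>s. s \<^bold>\<in> T \<^bold>\<and> (s \<^bold>\<subseteq> seq_name t \<^bold>\<or> seq_name t \<^bold>\<subseteq> s) \<^bold>\<and> z' \<^bold>\<in> s) r"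
      using s by (intro ex_intro[of _ s]) (simp_all add: and_iff ext_in)
  qed (use z in auto)
  obtain q where q: "q \<sqsubseteq> p"
    and dec: "\<forall>(i, j)\<in>D. below (opair (chk i) (chk j)) q \<or> (\<^bold>\<not> below (opair (chk i) (chk j))) q"
    using decide[of D "\<lambda>(i, j). below (opair (chk i) (chk j))" p] fin p unfolding D_def by fastforce
  \<comment> \<open>The points of \<open>D\<close> that \<open>q\<close> forces to be realized;
    \<open>q\<close> forces the remaining points of \<open>D\<close> not to be realized, so the
    remainder is fixed.\<close>
  define G where "G = {(i, j) \<in> D. below (opair (chk i) (chk j)) q}"
  have "(z \<^bold>\<in> graph_name G) r \<longleftrightarrow> (below z \<^bold>\<and> \<^bold>\<not> covered z) r" if z: "is_name z" "r \<sqsubseteq> q" for z r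
  proof
    note rP = ext_in(1)[OF z(2)]
    assume "(z \<^bold>\<in> graph_name G) r"
    then show "(below z \<^bold>\<and> \<^bold>\<not> covered z) r"
    proof (rule graph_elim)
      fix i j s assume s: "(i, j) \<in> G" "s \<sqsubseteq> r" "(z \<^bold>= opair (chk i) (chk j)) s"
      note sP = ext_in(1)[OF s(2)]
      have "below (opair (chk i) (chk j)) q"
        using s(1) by (simp add: G_def)
      then have "below (opair (chk i) (chk j)) s"
        by (rule reg_mono[rotated, OF _ ext_trans[OF s(2) z(2)]]) simp
      then have "below z s"
        by (rule below_cong) (use s z sP in \<open>auto simp: eq_commute\<close>)
      \<comment> \<open>Points of \<open>D\<close> avoid all graphs of members of \<open>X\<close>,
        whereas covering \<open>z\<close> would put its point on the graph of some
        \<open>h \<in> X\<close>.\<close>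
      moreover have "\<not> covered z a" if a: "a \<sqsubseteq> s" for a
      proof
        assume "covered z a"
        then show False
          unfolding covered_def
        proof (rule ex_elim[where \<chi> = "\<lambda>_. False"])
          fix f b assume f: "is_name f" "b \<sqsubseteq> a" "(f \<^bold>\<in> check_family X \<^bold>\<and> z \<^bold>\<in> f) b"
          then have "(f \<^bold>\<in> check_family X) b" "(z \<^bold>\<in> f) b" by (simp_all add: and_iff)
          from this(1) show False
          proof (rule family_elim[where \<psi> = "\<lambda>_. False"])
            fix h c assume h: "h \<in> X" "c \<sqsubseteq> b" "(f \<^bold>= graph_name (fun_graph h)) c"
            note c = ext_in(1)[OF h(2)]
            have cs: "c \<sqsubseteq> s" using h(2) f(2) a ext_trans by blast
            have "(z \<^bold>\<in> graph_name (fun_graph h)) c"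
              using mem_cong_right[OF mem_mono[OF \<open>(z \<^bold>\<in> f) b\<close> h(2)] h(3)] c f z by simp
            then have "(opair (chk i) (chk j) \<^bold>\<in> graph_name (fun_graph h)) c"
              using mem_cong_left[OF _ eq_mono[OF s(3) cs]] c z by simp
            then show False
              using s(1) h(1) c by (auto simp: graph_mem_iff G_def D_def)
          qed (use f in \<open>auto simp: ext_in\<close>)
        qed (use a in \<open>auto simp: ext_in\<close>)
      qed
      ultimately show "(below z \<^bold>\<and> \<^bold>\<not> covered z) s"
        using sP by (simp add: and_iff not_iff)
    qed (use rP in auto)
  next
    note rP = ext_in(1)[OF z(2)]
    assume "(below z \<^bold>\<and> \<^bold>\<not> covered z) r"
    then have b: "below z r" and nc: "(\<^bold>\<not> covered z) r" by (simp_all add: and_iff)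
    from b show "(z \<^bold>\<in> graph_name G) r"
      unfolding below_def
    proof (rule ex_elim)
      fix s a assume s: "is_name s" "a \<sqsubseteq> r" "(s \<^bold>\<in> T \<^bold>\<and> (s \<^bold>\<subseteq> seq_name t \<^bold>\<or> seq_name t \<^bold>\<subseteq> s) \<^bold>\<and> z \<^bold>\<in> s) a"
      note aP = ext_in(1)[OF s(2)]
      have ap: "a \<sqsubseteq> p" using s(2) z(2) q ext_trans by blast
      have s': "(s \<^bold>\<in> T) a" "(s \<^bold>\<subseteq> seq_name t \<^bold>\<or> seq_name t \<^bold>\<subseteq> s) a" "(z \<^bold>\<in> s) a"
        using s(3) by (simp_all add: and_iff)
      have "fm_seq w s a"
        using tree_seq[OF reg_mono[OF reg_fm(10) T ap] s'(1) s(1) aP] .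
      with reg_mono[OF reg_fm(7) w ap] show "(z \<^bold>\<in> graph_name G) a"
      proof (rule seq_elim)
        fix u b assume u: "b \<sqsubseteq> a" "(s \<^bold>= seq_name u) b"
        note bP = ext_in(1)[OF u(1)]
        have uT: "(seq_name u \<^bold>\<in> T) b"
          using mem_cong_left[OF mem_mono[OF s'(1) u(1)] u(2)] s bP by simp
        \<comment> \<open>\<open>S\<close> bounds \<open>T\<close> from outside, so every point
          contributed by \<open>u\<close> that lies on no graph from \<open>X\<close> belongs to the
          finite set \<open>D\<close>.\<close>
        then have uS: "u \<in> S"
          using S ext_trans[OF u(1) ap] by blast
        have "prefix u t \<or> prefix t u"
        proof (rule or_elim[where \<chi> = "\<lambda>_. prefix u t \<or> prefix t u"])
          show "(s \<^bold>\<subseteq> seq_name t \<^bold>\<or> seq_name t \<^bold>\<subseteq> s) b"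
            using s'(2) u(1) by (auto intro: reg_mono)
        next
          fix c assume c: "c \<sqsubseteq> b" "(s \<^bold>\<subseteq> seq_name t) c"
          then show "prefix u t \<or> prefix t u"
            using subset_cong_left[OF c(2) eq_mono[OF u(2) c(1)]] s
            by (simp add: ext_in graph_subset_iff seq_graph_subset_iff)
        next
          fix c assume c: "c \<sqsubseteq> b" "(seq_name t \<^bold>\<subseteq> s) c"
          then show "prefix u t \<or> prefix t u"
            using subset_cong_right[OF c(2) eq_mono[OF u(2) c(1)]] s
            by (simp add: ext_in graph_subset_iff seq_graph_subset_iff)
        qed (use bP in auto)
        then have sub: "u \<in> subtree_at S t" using uS by (auto simp: subtree_at_def)
        have "(z \<^bold>\<in> seq_name u) b"
          using mem_cong_right[OF mem_mono[OF s'(3) u(1)] u(2)] s z bP by simp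
        then show "(z \<^bold>\<in> graph_name G) b"
        proof (rule graph_elim)
          fix i j c assume c: "(i, j) \<in> seq_graph u" "c \<sqsubseteq> b" "(z \<^bold>= opair (chk i) (chk j)) c"
          note cP = ext_in(1)[OF c(2)]
          have cr: "c \<sqsubseteq> r" using c(2) u(1) s(2) ext_trans by blast
          have "(i, j) \<notin> fun_graph h" if h: "h \<in> X" for h
          proof
            assume "(i, j) \<in> fun_graph h"
            then have "(z \<^bold>\<in> graph_name (fun_graph h)) c"
              using c(3) cP by (auto intro: graph_memI)
            then have "covered z c"
              unfolding covered_def using cP family_mem[OF h cP]
              by (intro ex_intro[of _ "graph_name (fun_graph h)"]) (simp_all add: and_iff)
            then show False
              using nc cr rP by (simp add: not_iff)
          qed
          then have D: "(i, j) \<in> D" using c(1) sub by (auto simp: D_def)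
          have "below z c" using reg_mono[of "below z" r c] b cr by simp
          then have b': "below (opair (chk i) (chk j)) c"
            by (rule below_cong) (use c z cP in auto)
          have "c \<sqsubseteq> q" using cr z(2) by (rule ext_trans)
          \<comment> \<open>As the extension \<open>c\<close> realizes the point, \<open>q\<close>
            cannot have decided against it; being decided, the point is in \<open>G\<close>.\<close>
          then have "\<not> (\<^bold>\<not> below (opair (chk i) (chk j))) q"
            using b' ext_in(1)[OF q] by (auto simp: not_iff)
          then have "(i, j) \<in> G" using dec D by (auto simp: G_def)
          then show "(z \<^bold>\<in> graph_name G) c"
            using c(3) cP by (auto intro: graph_memI)
        qed (use bP in auto)
      qed (use s aP in auto)
    qed (use rP in auto)
  qed
  then have "fm_rest T (seq_name t) (check_family X) (graph_name G) q"
    using ext_in(1)[OF q] by (simp add: fm_rest_def all_iff iff_iff below_def covered_def)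
  moreover have "finite G"
    by (rule finite_subset[of _ D]) (use fin in \<open>auto simp: G_def D_def\<close>)
  ultimately show ?thesis using q by blast
qed

text \<open>Different nodes may be realized by different conditions and different names
  \<open>T\<close>. Closure under initial segments, pruning and positivity each concern a single
  node, so each reduces to a forced property of one \<open>T\<close> at one extension.\<close>

lemma possible_tree_positive:
  fixes F w :: "('i, 'p) pname"
  assumes w: "fm_omega w p" and n [simp]: "is_name w" "is_name F" and p: "p \<in> P"
    and pos: "\<And>n T q. is_name n \<Longrightarrow> is_name T \<Longrightarrow> q \<sqsubseteq> p \<Longrightarrow> (n \<^bold>\<in> w) q \<Longrightarrow> fm_app F n T q \<Longrightarrow>
      fm_positive w (check_family E) T q"
  shows "possible_tree F m p \<in> positive_trees E"
proof -
  let ?S = "possible_tree F m p"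
  have pos': "fm_positive w (check_family E) T q \<and> fm_omega w q"
    if "is_name T" "q \<sqsubseteq> p" "fm_app F (chk m) T q" for T q
    using that pos[of "chk m" T q] chk_mem_omega[of w q m] reg_mono[OF reg_fm(7) w] by (simp add: ext_in)
  have "s \<in> ?S" if "t \<in> ?S" "prefix s t" for s t
    using that(1)
  proof (rule possible_tree_cases)
    fix T q assume T: "is_name T" "q \<sqsubseteq> p" "fm_app F (chk m) T q" "(seq_name t \<^bold>\<in> T) q"
    then have "(seq_name s \<^bold>\<in> T) q"
      using pos'[OF T(1-3)] tree_prefix[OF positive_treeD(1)[of w "check_family E"] T(4) that(2)] T(2)
      by (simp add: ext_in)
    then show ?thesis using T by (blast intro: possible_treeI)
  qed
  moreover have "\<exists>s\<in>?S. strict_prefix t s" if "t \<in> ?S" for t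
    using that
  proof (rule possible_tree_cases)
    fix T q assume T: "is_name T" "q \<sqsubseteq> p" "fm_app F (chk m) T q" "(seq_name t \<^bold>\<in> T) q"
    then obtain s r where s: "strict_prefix t s" "r \<sqsubseteq> q" "(seq_name s \<^bold>\<in> T) r"
      using pos'[OF T(1-3)] tree_pruned[OF positive_treeD(1)[of w "check_family E"] T(4)]
      by (auto simp: ext_in)
    then have "s \<in> ?S"
      using T reg_mono[OF reg_fm(4) T(3) s(2)] ext_trans[OF s(2) T(2)] by (blast intro: possible_treeI)
    then show ?thesis using s(1) by blast
  qed
  moreover have False
    if t: "t \<in> ?S" and X: "finite X" "X \<subseteq> E"
      and fin: "finite (\<Union>(seq_graph ` subtree_at ?S t) - \<Union>(fun_graph ` X))" for t X
    using t
  proof (rule possible_tree_cases)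
    fix T q assume T: "is_name T" "q \<sqsubseteq> p" "fm_app F (chk m) T q" "(seq_name t \<^bold>\<in> T) q"
    note pq = pos'[OF T(1-3)]
    \<comment> \<open>The tree of possible nodes qualifies as the outer bound \<open>S\<close>: any
      node that an extension of \<open>q\<close> puts into \<open>T\<close> is possible for
      \<open>p\<close>.\<close>
    have "\<exists>r G. r \<sqsubseteq> q \<and> finite G \<and> fm_rest T (seq_name t) (check_family X) (graph_name G) r"
    proof (rule rest_decided[OF _ _ n(1) T(1) _ _ fin])
      fix s r assume s: "r \<sqsubseteq> q" "(seq_name s \<^bold>\<in> T) r"
      then show "s \<in> ?S"
        using T reg_mono[OF reg_fm(4) T(3) s(1)] ext_trans[OF s(1) T(2)] by (blast intro: possible_treeI)
    qed (use pq positive_treeD(1) T in \<open>auto simp: ext_in\<close>)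
    then obtain r G where r: "r \<sqsubseteq> q" "finite G"
        "fm_rest T (seq_name t) (check_family X) (graph_name G) r"
      by blast
    note rP = ext_in(1)[OF r(1)]
    have wr: "fm_omega w r" using pq reg_mono[OF reg_fm(7) _ r(1)] by blast
    have "(\<^bold>\<exists>D. fm_rest T (seq_name t) (check_family X) D \<^bold>\<and> fm_finite w D) r"
      using r rP wr by (intro ex_intro[of _ "graph_name G"]) (simp_all add: and_iff finite_graph)
    then have "(\<^bold>\<exists>t. \<^bold>\<exists>X. t \<^bold>\<in> T \<^bold>\<and> fm_finite w X \<^bold>\<and> X \<^bold>\<subseteq> check_family E \<^bold>\<and>
           (\<^bold>\<exists>D. fm_rest T t X D \<^bold>\<and> fm_finite w D)) r"
      using rP wr X mem_mono[OF T(4) r(1)]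
      by (intro ex_intro[of _ "seq_name t"] ex_intro[of _ "check_family X"])
        (simp_all add: and_iff finite_family family_subset)
    then show False
      using positive_treeD(2)[of w "check_family E" T q] pq r(1) T by (simp add: not_iff ext_in)
  qed
  ultimately show ?thesis
    unfolding positive_trees_def is_tree_def by blast
qed

section \<open>Preservation of tightness\<close>

lemma diagonalizes_seq:
  fixes T t :: "('i, 'p) pname"
  assumes t: "(t \<^bold>= seq_name u) p" and s: "(seq_name s \<^bold>\<in> T) p" "strict_prefix u s"
    and k: "length u \<le> k" "k < length s" "s ! k = g k"
    and n [simp]: "is_name t" "is_name T" and p: "p \<in> P"
  shows "(\<^bold>\<exists>s. s \<^bold>\<in> T \<^bold>\<and> t \<^bold>\<subseteq> s \<^bold>\<and> \<^bold>\<not> t \<^bold>= s \<^bold>\<and>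
           (\<^bold>\<exists>k. \<^bold>\<exists>y. \<^bold>\<not> (\<^bold>\<exists>y'. fm_app t k y') \<^bold>\<and> fm_app s k y \<^bold>\<and> fm_app (check_real g) k y)) p"
proof -
  have sub: "(t \<^bold>\<subseteq> seq_name s) p"
    using subset_cong_left[of "seq_name u" "seq_name s" p t] t s(2) p
    by (simp add: eq_commute graph_subset_iff seq_graph_subset_iff strict_prefix_def)
  have ne: "(\<^bold>\<not> t \<^bold>= seq_name s) p"
    unfolding not_iff[OF p]
  proof (intro allI impI notI)
    fix q assume q: "q \<sqsubseteq> p" "(t \<^bold>= seq_name s) q"
    have "(seq_name u \<^bold>= seq_name s) q"
      using eq_trans[of "seq_name u" t q "seq_name s"] eq_mono[OF t q(1)] q by (simp add: eq_commute ext_in)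
    then show False
      using q s(2) by (simp add: graph_eq_iff seq_graph_eq_iff ext_in strict_prefix_def)
  qed
  \<comment> \<open>From \<open>length u \<le> k\<close>: this expresses that \<open>k\<close> lies
    outside the domain of \<open>t\<close>.\<close>
  have undef: "(\<^bold>\<not> (\<^bold>\<exists>y'. fm_app t (chk k) y')) p"
    unfolding not_iff[OF p]
  proof (intro allI impI notI)
    fix q assume q: "q \<sqsubseteq> p" "(\<^bold>\<exists>y'. fm_app t (chk k) y') q"
    from q(2) show False
    proof (rule ex_elim[where \<chi> = "\<lambda>_. False"])
      fix y r assume y: "is_name y" "r \<sqsubseteq> q" "fm_app t (chk k) y r"
      note r = ext_in(1)[OF y(2)]
      have "(opair (chk k) y \<^bold>\<in> seq_name u) r"
        using app_cong[OF y(3) eq_mono[OF t ext_trans[OF y(2) q(1)]], of "chk k" y] y r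
        by (simp add: eq_refl app_iff)
      then show False
      proof (rule graph_elim[where \<psi> = "\<lambda>_. False"])
        fix i j a assume a: "(i, j) \<in> seq_graph u" "a \<sqsubseteq> r" "(opair (chk k) y \<^bold>= opair (chk i) (chk j)) a"
        then have "k = i"
          using opair_eqD[OF a(3)] y by (simp add: ext_in chk_eq_iff)
        then show False using a(1) k(1) by (auto simp: seq_graph_def)
      qed (use r in auto)
    qed (use q in \<open>auto simp: ext_in\<close>)
  qed
  have "fm_app (seq_name s) (chk k) (chk (g k)) p"
    using k p by (auto simp: app_iff graph_mem_iff seq_graph_def)
  moreover have "fm_app (check_real g) (chk k) (chk (g k)) p"
    using p by (auto simp: check_real_eq app_iff graph_mem_iff fun_graph_def)
  ultimately have "(\<^bold>\<exists>k. \<^bold>\<exists>y. \<^bold>\<not> (\<^bold>\<exists>y'. fm_app t k y') \<^bold>\<and> fm_app (seq_name s) k y \<^bold>\<and> fm_app (check_real g) k y) p"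
    using undef p by (intro ex_intro[of _ "chk k"] ex_intro[of _ "chk (g k)"]) (simp_all add: and_iff)
  then show ?thesis
    using sub ne s(1) p by (intro ex_intro[of _ "seq_name s"]) (simp_all add: and_iff)
qed

text \<open>
  The second hypothesis makes the trees \<open>possible_tree F m q\<close>, for all \<open>m\<close> and \<open>q\<close>, a countable
  family in the ground model, so that tightness applies to them.
\<close>

theorem forced_tight:
  assumes tight: "tight E"
    and countable: "\<And>\<Phi> :: nat \<times> nat list \<Rightarrow> 'p \<Rightarrow> bool.
      (\<And>j. reg (\<Phi> j)) \<Longrightarrow> countable ((\<lambda>p. {j. \<exists>q. q \<sqsubseteq> p \<and> \<Phi> j q}) ` P)"
  shows "forced (fm_tight (check_family E :: ('i, 'p) pname))"
proof -
  let ?E = "check_family E :: ('i, 'p) pname"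
  have main: "(\<^bold>\<exists>g. g \<^bold>\<in> ?E \<^bold>\<and>
      (\<^bold>\<forall>n. \<^bold>\<forall>T. n \<^bold>\<in> w \<^bold>\<and> fm_app F n T \<^bold>\<longrightarrow> fm_densely_diagonalizes g T)) p"
    if w: "fm_omega w p" and n [simp]: "is_name w" "is_name F" and p: "p \<in> P"
      and F: "fm_fun F w b p"
      and pos: "(\<^bold>\<forall>n. \<^bold>\<forall>T. n \<^bold>\<in> w \<^bold>\<and> fm_app F n T \<^bold>\<longrightarrow> fm_positive w ?E T) p" for w F b p
  proof -
    define \<T> where "\<T> = {possible_tree F m q | m q. q \<sqsubseteq> p}"
    \<comment> \<open>For each condition one set of pairs \<open>(m, s)\<close> codes its trees for
      all \<open>m\<close>; the trees are recovered as slices, so \<open>\<T>\<close> is an image of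
      a countable set.\<close>
    have "\<T> \<subseteq> (\<lambda>(m, A). {s. (m, s) \<in> A}) `
        (UNIV \<times> (\<lambda>p. {j. \<exists>q. q \<sqsubseteq> p \<and> (\<lambda>(m, s). tree_mem F m s) j q}) ` P)"
    proof
      fix S assume "S \<in> \<T>"
      then obtain m q where "q \<sqsubseteq> p" "S = possible_tree F m q" by (auto simp: \<T>_def)
      then show "S \<in> (\<lambda>(m, A). {s. (m, s) \<in> A}) `
        (UNIV \<times> (\<lambda>p. {j. \<exists>q. q \<sqsubseteq> p \<and> (\<lambda>(m, s). tree_mem F m s) j q}) ` P)"
        by (intro image_eqI[of _ _ "(m, {j. \<exists>r. r \<sqsubseteq> q \<and> (\<lambda>(m, s). tree_mem F m s) j r})"])
          (auto simp: possible_tree_def ext_in)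
    qed
    moreover have "countable \<dots>"
      by (intro countable_image countable_SIGMA countable) auto
    ultimately have "countable \<T>"
      using countable_subset by blast
    moreover have "\<T> \<noteq> {}"
      using ext_refl[OF p] by (auto simp: \<T>_def)
    ultimately have \<T>: "range (from_nat_into \<T>) = \<T>" by (rule range_from_nat_into[rotated])
    have "\<T> \<subseteq> positive_trees E"
    proof
      fix S assume "S \<in> \<T>"
      then obtain m q where q: "q \<sqsubseteq> p" "S = possible_tree F m q" by (auto simp: \<T>_def)
      have "fm_positive w ?E T r" if "is_name k" "is_name T" "r \<sqsubseteq> q" "(k \<^bold>\<in> w) r" "fm_app F k T r" for k T r
        using pos that p ext_trans[OF that(3) q(1)] by (simp add: all_iff imp_iff and_iff)
      then show "S \<in> positive_trees E"
        using possible_tree_positive[of w q F E m] reg_mono[OF reg_fm(7) w q(1)] q by (simp add: ext_in)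
    qed
    then obtain g where g: "g \<in> E" "\<And>n. densely_diagonalizes g (from_nat_into \<T> n)"
      using tight \<T> unfolding tight_def by (metis rangeI subsetD)
    have g': "densely_diagonalizes g S" if "S \<in> \<T>" for S
      using that g(2) \<T> by (metis imageE)
    have "(\<^bold>\<forall>n. \<^bold>\<forall>T. n \<^bold>\<in> w \<^bold>\<and> fm_app F n T \<^bold>\<longrightarrow> fm_densely_diagonalizes (check_real g) T) p"
    proof -
      have "(\<^bold>\<exists>s. s \<^bold>\<in> T \<^bold>\<and> t \<^bold>\<subseteq> s \<^bold>\<and> \<^bold>\<not> t \<^bold>= s \<^bold>\<and>
           (\<^bold>\<exists>k. \<^bold>\<exists>y. \<^bold>\<not> (\<^bold>\<exists>y'. fm_app t k y') \<^bold>\<and> fm_app s k y \<^bold>\<and> fm_app (check_real g) k y)) q" (is "?\<phi> q")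
        if T: "is_name k" "is_name T" "is_name t" "q \<sqsubseteq> p" "(k \<^bold>\<in> w) q" "fm_app F k T q" "(t \<^bold>\<in> T) q"
        for k T t q
      proof -
        note q = ext_in(1)[OF T(4)]
        note wq = reg_mono[OF reg_fm(7) w T(4)]
        note Fq = reg_mono[OF reg_fm(5) F T(4)]
        have "fm_positive w ?E T q"
          using pos T p by (simp add: all_iff imp_iff and_iff)
        then have seq: "fm_seq w t q"
          using tree_seq[OF positive_treeD(1) T(7,3) q] by blast
        from wq T(5) show "?\<phi> q"
        proof (rule omega_elim)
          fix m r assume m: "r \<sqsubseteq> q" "(k \<^bold>= chk m) r"
          note r = ext_in(1)[OF m(1)]
          have app: "fm_app F (chk m) T r"
            using app_cong[OF reg_mono[OF reg_fm(4) T(6) m(1)] _ m(2), of F T] T r by (simp add: eq_refl)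
          from reg_mono[OF reg_fm(7) wq m(1)] reg_mono[OF reg_fm(9) seq m(1)] show "?\<phi> r"
          proof (rule seq_elim)
            fix u a assume u: "a \<sqsubseteq> r" "(t \<^bold>= seq_name u) a"
            have ar: "a \<sqsubseteq> q" using ext_trans[OF u(1) m(1)] .
            note aP = ext_in(1)[OF ar]
            show "?\<phi> a"
            proof (rule reg_dense)
              fix c assume c: "c \<sqsubseteq> a"
              note cP = ext_in(1)[OF c]
              have cr: "c \<sqsubseteq> r" using ext_trans[OF c u(1)] .
              have cq: "c \<sqsubseteq> q" using ext_trans[OF c ar] .
              have "(seq_name u \<^bold>\<in> T) c"
                using mem_cong_left[OF mem_mono[OF T(7) cq] eq_mono[OF u(2) c]] T cP by simp
              then have "u \<in> possible_tree F m c"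
                using reg_mono[OF reg_fm(4) app cr] T cP by (intro possible_treeI[of F m T c]) simp_all
              moreover have "possible_tree F m c \<in> \<T>"
                using ext_trans[OF cq T(4)] by (auto simp: \<T>_def)
              ultimately obtain s l where s: "s \<in> possible_tree F m c" "strict_prefix u s"
                  "length u \<le> l" "l < length s" "s ! l = g l"
                using g' unfolding densely_diagonalizes_def by blast
              from s(1) show "\<exists>d. d \<sqsubseteq> c \<and> ?\<phi> d"
              proof (rule possible_tree_cases)
                fix T' d assume d: "is_name T'" "d \<sqsubseteq> c" "fm_app F (chk m) T' d" "(seq_name s \<^bold>\<in> T') d"
                note dP = ext_in(1)[OF d(2)]
                \<comment> \<open>\<open>s\<close> was realized through a possibly different name
                  for the \<open>m\<close>-th tree; both names are values of \<open>F\<close> at the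
                  same numeral.\<close>
                have "(T' \<^bold>= T) d"
                  using fun_unique[OF reg_mono[OF reg_fm(5) Fq ext_trans[OF d(2) cq]] d(3)
                    reg_mono[OF reg_fm(4) app ext_trans[OF d(2) cr]]] T d dP by simp
                then have "(seq_name s \<^bold>\<in> T) d"
                  using mem_cong_right[OF d(4)] d T dP by simp
                then have "?\<phi> d"
                  using diagonalizes_seq[of t u d s T l g] eq_mono[OF u(2) ext_trans[OF d(2) c]] s(2-5) T dP
                  by simp
                then show ?thesis using d(2) by blast
              qed
            qed (use aP in auto)
          qed (use T r in auto)
        qed (use T q in auto)
      qed
      then show ?thesis
        using p unfolding fm_densely_diagonalizes_def
        by (simp add: all_iff imp_iff and_iff ext_in) (meson ext_trans mem_mono reg_fm(4) reg_mono reg_mem)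
    qed
    then show ?thesis
      using g(1) p family_mem[OF g(1) p]
      by (intro ex_intro[of _ "check_real g"]) (simp_all add: and_iff check_real_eq)
  qed
  show ?thesis
    unfolding forced_def fm_tight_def
  proof (intro ballI)
    fix p assume p: "p \<in> P"
    have "(\<^bold>\<exists>g. g \<^bold>\<in> ?E \<^bold>\<and>
      (\<^bold>\<forall>n. \<^bold>\<forall>T. n \<^bold>\<in> w \<^bold>\<and> fm_app F n T \<^bold>\<longrightarrow> fm_densely_diagonalizes g T)) r"
      if w: "is_name w" "q \<sqsubseteq> p" "fm_omega w q" and F: "is_name F" "r \<sqsubseteq> q"
        "(\<^bold>\<exists>b. fm_fun F w b) r"
        "(\<^bold>\<forall>n. \<^bold>\<forall>T. n \<^bold>\<in> w \<^bold>\<and> fm_app F n T \<^bold>\<longrightarrow> fm_positive w ?E T) r" for w q F r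
      using F(3)
    proof (rule ex_elim)
      fix b a assume b: "is_name b" "a \<sqsubseteq> r" "fm_fun F w b a"
      show "(\<^bold>\<exists>g. g \<^bold>\<in> ?E \<^bold>\<and>
        (\<^bold>\<forall>n. \<^bold>\<forall>T. n \<^bold>\<in> w \<^bold>\<and> fm_app F n T \<^bold>\<longrightarrow> fm_densely_diagonalizes g T)) a"
      proof (rule main[OF _ w(1) F(1) _ b(3)])
        show "fm_omega w a" using w(3) ext_trans[OF b(2) F(2)] by (rule reg_mono[OF reg_fm(7)])
        have "reg (\<^bold>\<forall>n. \<^bold>\<forall>T. n \<^bold>\<in> w \<^bold>\<and> fm_app F n T \<^bold>\<longrightarrow> fm_positive w ?E T)"
          by simp
        from this F(4) b(2)
        show "(\<^bold>\<forall>n. \<^bold>\<forall>T. n \<^bold>\<in> w \<^bold>\<and> fm_app F n T \<^bold>\<longrightarrow> fm_positive w ?E T) a"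
          by (rule reg_mono)
      qed (use b in \<open>simp add: ext_in\<close>)
    qed (use F in \<open>auto simp: ext_in\<close>)
    then show "(\<^bold>\<forall>w. fm_omega w \<^bold>\<longrightarrow>
        (\<^bold>\<forall>F. (\<^bold>\<exists>b. fm_fun F w b) \<^bold>\<and>
             (\<^bold>\<forall>n. \<^bold>\<forall>T. n \<^bold>\<in> w \<^bold>\<and> fm_app F n T \<^bold>\<longrightarrow> fm_positive w ?E T) \<^bold>\<longrightarrow>
           (\<^bold>\<exists>g. g \<^bold>\<in> ?E \<^bold>\<and>
             (\<^bold>\<forall>n. \<^bold>\<forall>T. n \<^bold>\<in> w \<^bold>\<and> fm_app F n T \<^bold>\<longrightarrow> fm_densely_diagonalizes g T)))) p"
      using p by (simp add: all_iff[of _ p] all_iff[of "\<lambda>F. _ F \<^bold>\<longrightarrow> _ F"] imp_iff and_iff ext_in)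
  qed
qed

end

section \<open>Cohen forcing\<close>

text \<open>Each such function is determined by its graph, a finite subset of the countable set
  \<open>S \<times> UNIV\<close>.\<close>

lemma countable_finite_partial_functions:
  fixes S :: "'c set"
  assumes "countable S"
  shows "countable {p :: 'c \<Rightarrow> bool option. finite (dom p) \<and> dom p \<subseteq> S}"
proof -
  let ?C = "{p :: 'c \<Rightarrow> bool option. finite (dom p) \<and> dom p \<subseteq> S}"
  have "Map.graph ` ?C \<subseteq> {A. finite A \<and> A \<subseteq> S \<times> UNIV}"
    by (auto simp: finite_graph_iff_finite_dom dest!: in_graphD)
  moreover have "countable {A. finite A \<and> A \<subseteq> S \<times> (UNIV :: bool set)}"
    using assms by (intro countable_Collect_finite_subset) auto
  ultimately have "countable (Map.graph ` ?C)"
    using countable_subset by blast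
  moreover have "inj_on Map.graph ?C"
    by (intro inj_onI ext) (metis graph_domD graph_eq_to_snd_dom in_graphI in_graphD not_None_eq)
  ultimately show ?thesis
    by (rule countable_image_inj_on)
qed

text \<open>
  The set \<open>U\<close> of coordinates below is closed under choosing witnesses, so the existence of an
  extension of \<open>p\<close> satisfying \<open>\<Phi> j\<close> depends only on the restriction of \<open>p\<close> to \<open>U\<close>: a witness for
  that restriction with domain inside \<open>U\<close> is compatible with \<open>p\<close>.
\<close>

lemma countable_Add_omega:
  fixes \<Phi> :: "'j :: countable \<Rightarrow> ('k \<times> nat \<Rightarrow> bool option) \<Rightarrow> bool" and \<kappa> :: "'k rel"
  assumes mono: "\<And>j p q. \<Phi> j p \<Longrightarrow> p \<in> Add_omega \<kappa> \<Longrightarrow> q \<in> Add_omega \<kappa> \<Longrightarrow> Add_le q p \<Longrightarrow> \<Phi> j q"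
  shows "countable ((\<lambda>p. {j. \<exists>q\<in>Add_omega \<kappa>. Add_le q p \<and> \<Phi> j q}) ` Add_omega \<kappa>)"
proof -
  let ?P = "Add_omega \<kappa>"
  define R where "R p j = (SOME q. q \<in> ?P \<and> Add_le q p \<and> \<Phi> j q)" for p j
  define C where "C S = {p \<in> ?P. dom p \<subseteq> S}" for S
  have C: "countable (C S)" if "countable S" for S
    by (rule countable_subset[OF _ countable_finite_partial_functions[OF that]])
      (auto simp: C_def Add_omega_def)
  have R: "R p j \<in> ?P \<and> Add_le (R p j) p \<and> \<Phi> j (R p j)" if "\<exists>q\<in>?P. Add_le q p \<and> \<Phi> j q" for p j
    unfolding R_def using someI_ex[of "\<lambda>q. q \<in> ?P \<and> Add_le q p \<and> \<Phi> j q"] that by blast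
  \<comment> \<open>The default \<open>{}\<close> applies when no witness exists and
    \<open>R p j\<close> is arbitrary; it keeps every \<open>D p j\<close> finite.\<close>
  define D where "D p j = (if \<exists>q\<in>?P. Add_le q p \<and> \<Phi> j q then dom (R p j) else {})" for p j
  have D: "finite (D p j)" for p j
    using R[of p j] by (auto simp: D_def Add_omega_def)
  \<comment> \<open>Over a countable \<open>S\<close> there are countably many conditions and
    countably many \<open>j\<close>, each contributing a finite set, so one step preserves
    countability.\<close>
  define step where "step S = S \<union> (\<Union>p\<in>C S. \<Union>j. D p j)" for S
  define S where "S n = (step ^^ n) {}" for n
  have S_countable: "countable (S n)" for n
    by (induction n) (auto simp: S_def step_def D C countable_finite intro!: countable_UN)
  have S_mono: "S m \<subseteq> S n" if "m \<le> n" for m n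
    using that by (rule lift_Suc_mono_le[of S, rotated]) (auto simp: S_def step_def)
  define U where "U = (\<Union>n. S n)"
  \<comment> \<open>Finitely many coordinates already appear at a single finite stage, so \<omega>
    stages suffice for closure.\<close>
  have U: "D p j \<subseteq> U" if p: "p \<in> C U" for p j
  proof -
    have "finite (dom p)" "dom p \<subseteq> (\<Union>n. S n)"
      using p by (auto simp: C_def Add_omega_def U_def)
    then have "\<exists>n. dom p \<subseteq> S n"
    proof (induction rule: finite_subset_induct)
      case (insert x A)
      then obtain m n where "x \<in> S m" "A \<subseteq> S n" by blast
      then have "insert x A \<subseteq> S (max m n)"
        using S_mono[of m "max m n"] S_mono[of n "max m n"] by auto
      then show ?case ..
    qed simp
    then obtain n where "dom p \<subseteq> S n" ..
    then have "p \<in> C (S n)" using p by (auto simp: C_def)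
    then have "D p j \<subseteq> S (Suc n)" by (auto simp: S_def step_def)
    then show ?thesis by (auto simp: U_def)
  qed
  have CU: "p |` U \<in> C U" if "p \<in> ?P" for p
    using that by (auto simp: C_def Add_omega_def)
  have "(\<exists>q\<in>?P. Add_le q p \<and> \<Phi> j q) \<longleftrightarrow> (\<exists>q\<in>?P. Add_le q (p |` U) \<and> \<Phi> j q)" if p: "p \<in> ?P" for p j
  proof
    assume "\<exists>q\<in>?P. Add_le q p \<and> \<Phi> j q"
    moreover have "p |` U \<subseteq>\<^sub>m p" by (auto simp: map_le_def)
    ultimately show "\<exists>q\<in>?P. Add_le q (p |` U) \<and> \<Phi> j q"
      unfolding Add_le_def using map_le_trans by blast
  next
    note pU = CU[OF p]
    assume ex: "\<exists>q\<in>?P. Add_le q (p |` U) \<and> \<Phi> j q"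
    define r where "r = R (p |` U) j"
    have r: "r \<in> ?P" "Add_le r (p |` U)" "\<Phi> j r"
      using R[OF ex] by (auto simp: r_def)
    have dom_r: "dom r \<subseteq> U"
      using U[OF pU, of j] ex by (simp add: D_def r_def)
    \<comment> \<open>Since \<open>++\<close> gives precedence to \<open>p\<close>, only agreement
      with \<open>r\<close> needs an argument. Common coordinates lie in \<open>U\<close>, where
      \<open>r\<close> extends the restriction of \<open>p\<close>.\<close>
    have "(r ++ p) a = r a" if "a \<in> dom r" for a
    proof (cases "p a")
      case (Some v)
      have "a \<in> U" using that dom_r by blast
      then have "(p |` U) a = Some v" using Some by simp
      then have "r a = Some v"
        using r(2) unfolding Add_le_def map_le_def by (metis domI)
      then show ?thesis using Some by (simp add: map_add_def)
    qed (simp add: map_add_def)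
    then have "Add_le (r ++ p) r" "Add_le (r ++ p) p"
      by (auto simp: Add_le_def map_le_def[of r])
    moreover have "r ++ p \<in> ?P"
      using r(1) p by (auto simp: Add_omega_def)
    ultimately show "\<exists>q\<in>?P. Add_le q p \<and> \<Phi> j q"
      using mono[OF r(3,1)] by blast
  qed
  then have *: "{j. \<exists>q\<in>?P. Add_le q p \<and> \<Phi> j q} = {j. \<exists>q\<in>?P. Add_le q (p |` U) \<and> \<Phi> j q}" if "p \<in> ?P" for p
    using that by blast
  have "(\<lambda>p. {j. \<exists>q\<in>?P. Add_le q p \<and> \<Phi> j q}) ` ?P \<subseteq>
      (\<lambda>p. {j. \<exists>q\<in>?P. Add_le q p \<and> \<Phi> j q}) ` C U"
  proof (rule image_subsetI)
    fix p assume "p \<in> ?P"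
    then show "{j. \<exists>q\<in>?P. Add_le q p \<and> \<Phi> j q} \<in> (\<lambda>p. {j. \<exists>q\<in>?P. Add_le q p \<and> \<Phi> j q}) ` C U"
      unfolding *[OF \<open>p \<in> ?P\<close>] by (intro imageI CU)
  qed
  moreover have "countable (C U)"
    unfolding U_def using S_countable by (intro C countable_UN) auto
  ultimately show ?thesis
    by (metis (no_types, lifting) countable_image countable_subset)
qed

text \<open>The cardinality assumptions let the names over \<open>'i\<close> represent all names in
  \<open>H(\<lambda>\<^sup>+)\<close>, for \<open>\<lambda>\<close> the size of \<open>'i\<close>,
  with \<open>\<lambda>\<close> at least the continuum and hence at least the size of
  \<open>E\<close>; this gives the forced sentence its usual meaning.\<close>

theorem theorem3p1:
  fixes \<kappa> :: "'k rel"
    and E :: "(nat \<Rightarrow> nat) set"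
  assumes "Card_order \<kappa>"
    and "ed_family E"
    and "tight E"
    and "|UNIV :: (nat \<Rightarrow> nat) set| \<le>o |UNIV :: 'i set|"
    and "|Add_omega \<kappa>| \<le>o |UNIV :: 'i set|"
  shows "forcing_notion.forced (Add_omega \<kappa>)
           (forcing_notion.fm_tight (Add_omega \<kappa>) Add_le
              (forcing_notion.check_family Map.empty E :: ('i, 'k \<times> nat \<Rightarrow> bool option) pname))"
proof -
  interpret forcing_notion "Add_omega \<kappa>" Add_le Map.empty
    by (rule forcing_notion_Add)
  interpret forcing_index "Add_omega \<kappa>" Add_le Map.empty "TYPE('i)"
    by unfold_locales (rule assms(4))
  show ?thesis
  proof (rule forced_tight[OF assms(3)])
    fix \<Phi> :: "nat \<times> nat list \<Rightarrow> ('k \<times> nat \<Rightarrow> bool option) \<Rightarrow> bool"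
    assume "\<And>j. reg (\<Phi> j)"
    then have "countable ((\<lambda>p. {j. \<exists>q\<in>Add_omega \<kappa>. Add_le q p \<and> \<Phi> j q}) ` Add_omega \<kappa>)"
      by (intro countable_Add_omega) (meson ext_def reg_mono)
    also have "(\<lambda>p. {j. \<exists>q\<in>Add_omega \<kappa>. Add_le q p \<and> \<Phi> j q}) ` Add_omega \<kappa> =
        (\<lambda>p. {j. \<exists>q. ext q p \<and> \<Phi> j q}) ` Add_omega \<kappa>"
      by (rule image_cong) (auto simp: ext_def)
    finally show "countable ((\<lambda>p. {j. \<exists>q. ext q p \<and> \<Phi> j q}) ` Add_omega \<kappa>)" .
  qed
qed

end
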